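(* Let $A$ be the generator of a bounded $C_0$-semigroup $(e^{At})_{t\ge0}$ on a Hilbert space $H$. Suppose there exist $\beta>1$, $M>0$ and $t_0>1$ such that \[ \big\|e^{At}(I-A)^{-1}\big\|\le\frac{M}{(\log t)^{\beta}}\qquad\text{for all }t\ge t_0 . \] Then \[ \sup_{t\ge0}\big\|e^{A^{-1}t}A^{-1}\big\|<\infty . \] In particular, this holds whenever $A$ generates a polynomially stable $C_0$-semigroup on $H$ (with any parameter $\beta>0$).
   Context: Under the stated decay hypothesis it is known that $i\mathbb{R}\cap\sigma(A)=\emptyset$; in particular $A^{-1}\in\mathcal{L}(H)$ and $e^{A^{-1}t}$ is the exponential of the bounded operator $tA^{-1}$. A $C_0$-semigroup $(e^{At})_{t\ge0}$ on a Hilbert space is called polynomially stable with parameter $\beta>0$ if it is bounded and there exist $M,t_0>0$ with $\|e^{At}(I-A)^{-1}\|\le M t^{-1/\beta}$ for all $t\ge t_0$. *)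

theory Defs
  imports "HOL-Analysis.Analysis"
begin

definition c0_semigroup :: "(real \<Rightarrow> ('a::real_normed_vector \<Rightarrow>\<^sub>L 'a)) \<Rightarrow> bool" where
  "c0_semigroup T \<longleftrightarrow>
     T 0 = id_blinfun \<and>
     (\<forall>s\<ge>0. \<forall>t\<ge>0. T (s + t) = T s o\<^sub>L T t) \<and>
     (\<forall>x. ((\<lambda>t. blinfun_apply (T t) x) \<longlongrightarrow> x) (at_right 0))"

definition bounded_semigroup :: "(real \<Rightarrow> ('a::real_normed_vector \<Rightarrow>\<^sub>L 'a)) \<Rightarrow> bool" where
  "bounded_semigroup T \<longleftrightarrow> (\<exists>K. \<forall>t\<ge>0. norm (T t) \<le> K)"

definition gen_dom :: "(real \<Rightarrow> ('a::real_normed_vector \<Rightarrow>\<^sub>L 'a)) \<Rightarrow> 'a set" where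
  "gen_dom T = {x. \<exists>y. ((\<lambda>h. (1 / h) *\<^sub>R (blinfun_apply (T h) x - x)) \<longlongrightarrow> y) (at_right 0)}"

definition gen :: "(real \<Rightarrow> ('a::real_normed_vector \<Rightarrow>\<^sub>L 'a)) \<Rightarrow> 'a \<Rightarrow> 'a" where
  "gen T x = Lim (at_right 0) (\<lambda>h. (1 / h) *\<^sub>R (blinfun_apply (T h) x - x))"

definition bounded_inverse_of :: "'a set \<Rightarrow> ('a \<Rightarrow> 'a) \<Rightarrow> ('a::real_normed_vector \<Rightarrow>\<^sub>L 'a) \<Rightarrow> bool" where
  "bounded_inverse_of D f B \<longleftrightarrow>
     (\<forall>x. blinfun_apply B x \<in> D \<and> f (blinfun_apply B x) = x) \<and>
     (\<forall>x\<in>D. blinfun_apply B (f x) = x)"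

fun blinfun_pow :: "('a::real_normed_vector \<Rightarrow>\<^sub>L 'a) \<Rightarrow> nat \<Rightarrow> ('a \<Rightarrow>\<^sub>L 'a)" where
  "blinfun_pow B 0 = id_blinfun"
| "blinfun_pow B (Suc n) = B o\<^sub>L blinfun_pow B n"

definition blinfun_exp :: "('a::real_normed_vector \<Rightarrow>\<^sub>L 'a) \<Rightarrow> ('a \<Rightarrow>\<^sub>L 'a)" where
  "blinfun_exp B = (\<Sum>n. (1 / fact n) *\<^sub>R blinfun_pow B n)"

end

theory Submission
  imports Defs
begin

text \<open>
  Let \<open>\<rho>\<^sub>a = (a - A)\<^sup>-\<^sup>1\<close>; then \<open>A\<^sup>-\<^sup>1 = - \<rho>\<^sub>0\<close> and \<open>A\<^sup>-\<^sup>1 = R (A\<^sup>-\<^sup>1 - I)\<close>, so it suffices to bound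
  \<open>exp (- t \<rho>\<^sub>0) R\<close>. The energy \<open>V\<^sub>a z = \<integral> exp (- 2 a s) \<parallel>T(s) z\<parallel>\<^sup>2 ds\<close> satisfies
  \<open>d/dt V\<^sub>a (exp (- t \<rho>\<^sub>a) z) = - \<parallel>\<rho>\<^sub>a exp (- t \<rho>\<^sub>a) z\<parallel>\<^sup>2\<close>, and the same holds for the adjoint
  semigroup. By Duhamel's formula and Cauchy--Schwarz,
  \<open>\<bar>\<langle>(exp (- t \<rho>\<^sub>a) - exp (- t \<rho>\<^sub>b)) z, y\<rangle>\<bar> \<le> \<bar>a - b\<bar> \<surd>(V\<^sub>b z \<cdot> V*\<^sub>a y)\<close>. Here \<open>V*\<^sub>a y\<close> is at most
  \<open>K\<^sup>2 \<parallel>y\<parallel>\<^sup>2 / (2 a)\<close>, while for \<open>z\<close> in the range of \<open>R\<close> the decay hypothesis improves \<open>V\<^sub>b z\<close> by a factor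
  \<open>(log (1 / b))\<^sup>-\<^sup>2\<^sup>\<beta>\<close>. Along \<open>a = 2\<^sup>-\<^sup>k\<close> the differences are therefore of order \<open>k\<^sup>-\<^sup>\<beta>\<close>, which is
  summable since \<open>\<beta> > 1\<close>. The starting value \<open>exp (- t R) R\<close> is bounded by a similar energy argument.
  To have adjoints of bounded operators only, \<open>A\<close> is replaced by the difference quotients
  \<open>(T(h) - I) / h\<close> and \<open>h\<close> tends to \<open>0\<close> at the end.
\<close>

subsection \<open>Exponentials of bounded operators\<close>

text \<open>
  The class \<open>banach\<close> is not implied by \<open>real_normed_vector\<close> together with \<open>complete_space\<close>, so the
  library results on series in Banach spaces do not apply at the type of the theorem.
\<close>

lemma summable_norm_complete:
  fixes f :: "nat \<Rightarrow> 'a::{real_normed_vector, complete_space}"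
  assumes "summable (\<lambda>n. norm (f n))"
  shows "summable f"
proof -
  have "Cauchy (\<lambda>n. sum f {..<n})"
  proof (rule metric_CauchyI)
    fix e :: real assume "e > 0"
    have "Cauchy (\<lambda>n. \<Sum>i<n. norm (f i))"
      using assms by (simp add: summable_iff_convergent Cauchy_convergent_iff)
    then obtain M where M: "\<And>m n. m \<ge> M \<Longrightarrow> n \<ge> M \<Longrightarrow>
        dist (\<Sum>i<m. norm (f i)) (\<Sum>i<n. norm (f i)) < e"
      using \<open>e > 0\<close> unfolding Cauchy_def by meson
    have *: "dist (sum f {..<m}) (sum f {..<n}) < e" if "m \<ge> M" "n \<ge> m" for m n
    proof -
      have eq: "sum g {..<n} - sum g {..<m} = sum g {m..<n}" for g :: "nat \<Rightarrow> 'c::ab_group_add"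
        using that(2) by (simp add: sum_diff_nat_ivl lessThan_atLeast0)
      have "dist (sum f {..<m}) (sum f {..<n}) \<le> (\<Sum>i=m..<n. norm (f i))"
        by (simp add: dist_norm norm_minus_commute[of "sum f {..<m}"] eq norm_sum)
      also have "\<dots> = dist (\<Sum>i<m. norm (f i)) (\<Sum>i<n. norm (f i))"
        using sum_nonneg[of "{m..<n}" "\<lambda>i. norm (f i)"]
        by (simp add: dist_norm abs_minus_commute[of "\<Sum>i<m. norm (f i)"] eq)
      also have "\<dots> < e" using M that by auto
      finally show ?thesis .
    qed
    show "\<exists>M. \<forall>m\<ge>M. \<forall>n\<ge>M. dist (sum f {..<m}) (sum f {..<n}) < e"
      using * by (metis dist_commute nle_le)
  qed
  then show ?thesis by (simp add: summable_iff_convergent Cauchy_convergent)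
qed

text \<open>The pointwise sums define a bounded operator, and a tail estimate that is uniform on the
  unit ball upgrades pointwise convergence to convergence in operator norm.\<close>

lemma summable_norm_blinfun:
  fixes f :: "nat \<Rightarrow> 'a::real_normed_vector \<Rightarrow>\<^sub>L 'b::{real_normed_vector, complete_space}"
  assumes "summable (\<lambda>n. norm (f n))"
  shows "summable f"
proof -
  have sx: "summable (\<lambda>n. norm (f n x))" for x
    by (rule summable_comparison_test'[OF summable_mult2[OF assms, of "norm x"]])
       (simp add: norm_blinfun)
  have sums: "(\<lambda>n. f n x) sums (\<Sum>n. f n x)" for x
    using summable_norm_complete[OF sx] by (rule summable_sums)
  \<comment> \<open>The factor of \<open>norm x\<close> does not depend on \<open>x\<close>. The
    case \<open>m = 0\<close> also gives the boundedness of the limit.\<close>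
  have tail: "norm ((\<Sum>n. f n x) - (\<Sum>i<m. f i x)) \<le> (\<Sum>n. norm (f (n + m))) * norm x" for m x
  proof -
    have "(\<lambda>n. f (n + m) x) sums ((\<Sum>n. f n x) - (\<Sum>i<m. f i x))"
      using sums by (rule sums_split_initial_segment)
    moreover have "(\<lambda>n. norm (f (n + m)) * norm x) sums ((\<Sum>n. norm (f (n + m))) * norm x)"
      by (intro sums_mult2 summable_sums summable_ignore_initial_segment[OF assms])
    ultimately have "(\<lambda>k. norm (\<Sum>n<k. f (n + m) x)) \<longlonglongrightarrow> norm ((\<Sum>n. f n x) - (\<Sum>i<m. f i x))"
      "(\<lambda>k. \<Sum>n<k. norm (f (n + m)) * norm x) \<longlonglongrightarrow> (\<Sum>n. norm (f (n + m))) * norm x"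
      by (auto simp: sums_def intro: tendsto_norm)
    moreover have "norm (\<Sum>n<k. f (n + m) x) \<le> (\<Sum>n<k. norm (f (n + m)) * norm x)" for k
      by (rule sum_norm_le) (simp add: norm_blinfun)
    ultimately show ?thesis by (meson LIMSEQ_le)
  qed
  have bl: "bounded_linear (\<lambda>x. \<Sum>n. f n x)"
  proof (rule bounded_linear_intro)
    show "(\<Sum>n. f n (x + y)) = (\<Sum>n. f n x) + (\<Sum>n. f n y)" for x y
      using sums_add[OF sums[of x] sums[of y]] by (simp add: blinfun.add_right sums_iff)
    show "(\<Sum>n. f n (r *\<^sub>R x)) = r *\<^sub>R (\<Sum>n. f n x)" for r x
      using sums_scaleR_right[OF sums[of x], of r] by (simp add: blinfun.scaleR_right sums_iff)
    show "norm (\<Sum>n. f n x) \<le> norm x * (\<Sum>n. norm (f n))" for x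
      using tail[of x 0] by (simp add: mult.commute)
  qed
  define S where "S = Blinfun (\<lambda>x. \<Sum>n. f n x)"
  have S: "S x = (\<Sum>n. f n x)" for x
    unfolding S_def by (simp add: bounded_linear_Blinfun_apply[OF bl])
  have tail0: "(\<lambda>m. \<Sum>n. norm (f (n + m))) \<longlonglongrightarrow> 0"
  proof -
    have "(\<lambda>m. (\<Sum>n. norm (f n)) - (\<Sum>i<m. norm (f i))) \<longlonglongrightarrow> 0"
      using tendsto_diff[OF tendsto_const summable_LIMSEQ[OF assms]] by (metis diff_self)
    then show ?thesis by (simp add: suminf_minus_initial_segment[OF assms])
  qed
  have nn: "0 \<le> (\<Sum>n. norm (f (n + m)))" for m
    by (intro suminf_nonneg summable_ignore_initial_segment[OF assms]) auto
  have bnd: "norm ((\<Sum>i<m. f i) - S) \<le> (\<Sum>n. norm (f (n + m)))" for m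
    using tail[of _ m] nn
    by (intro norm_blinfun_bound)
       (auto simp: blinfun.diff_left blinfun.sum_left S norm_minus_commute)
  have "(\<lambda>m. (\<Sum>i<m. f i) - S) \<longlonglongrightarrow> 0"
    by (rule Lim_null_comparison[OF _ tail0]) (simp add: bnd)
  then have "f sums S" unfolding sums_def by (rule LIM_zero_cancel)
  then show ?thesis by (rule sums_summable)
qed

lemma blinfun_apply_suminf:
  assumes "summable f"
  shows "(\<lambda>n. blinfun_apply (f n) x) sums blinfun_apply (suminf f) x"
  by (rule bounded_linear.sums[OF blinfun.bounded_linear_left summable_sums[OF assms]])

lemma norm_blinfun_pow: "norm (blinfun_pow X n) \<le> norm X ^ n"
proof (induction n)
  case (Suc n)
  have "norm (blinfun_pow X (Suc n)) \<le> norm X * norm (blinfun_pow X n)"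
    by (simp add: norm_blinfun_compose)
  also have "\<dots> \<le> norm X * norm X ^ n" using Suc by (intro mult_left_mono) auto
  finally show ?case by simp
qed (simp add: norm_blinfun_id_le)

lemma blinfun_pow_scaleR: "blinfun_pow (s *\<^sub>R X) n = s ^ n *\<^sub>R blinfun_pow X n"
  by (induction n) (auto intro!: blinfun_eqI simp: blinfun.scaleR_left blinfun.scaleR_right mult.commute)

lemma blinfun_pow_commute:
  fixes X Y :: "'a::real_normed_vector \<Rightarrow>\<^sub>L 'a"
  assumes "\<And>x. blinfun_apply Y (X x) = X (Y x)"
  shows "blinfun_apply Y (blinfun_pow X n x) = blinfun_pow X n (Y x)"
  by (induction n arbitrary: x) (auto simp: assms)

lemma blinfun_pow_Suc_right: "blinfun_apply (blinfun_pow X (Suc n)) x = blinfun_pow X n (X x)"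
  using blinfun_pow_commute[of X X n x] by simp

lemma summable_norm_exp:
  "summable (\<lambda>n. norm ((1 / fact n) *\<^sub>R blinfun_pow X n))"
proof -
  have "summable (\<lambda>n. norm X ^ n /\<^sub>R fact n)" by (rule summable_exp_generic)
  then show ?thesis
    by (rule summable_comparison_test'[where N = 0]) (simp add: norm_blinfun_pow field_simps)
qed

lemma summable_blinfun_exp:
  fixes X :: "'a::{real_normed_vector, complete_space} \<Rightarrow>\<^sub>L 'a"
  shows "summable (\<lambda>n. (1 / fact n) *\<^sub>R blinfun_pow X n)"
  by (rule summable_norm_blinfun[OF summable_norm_exp])

lemma blinfun_exp_sums:
  fixes X :: "'a::{real_normed_vector, complete_space} \<Rightarrow>\<^sub>L 'a"
  shows "(\<lambda>n. (s ^ n / fact n) *\<^sub>R blinfun_pow X n) sums blinfun_exp (s *\<^sub>R X)"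
  using summable_sums[OF summable_blinfun_exp[of "s *\<^sub>R X"]]
  by (simp add: blinfun_exp_def blinfun_pow_scaleR)

lemma blinfun_exp_sums_apply:
  fixes X :: "'a::{real_normed_vector, complete_space} \<Rightarrow>\<^sub>L 'a"
  shows "(\<lambda>n. (1 / fact n) *\<^sub>R blinfun_pow X n x) sums blinfun_exp X x"
  using blinfun_apply_suminf[OF summable_blinfun_exp[of X], of x]
  by (simp add: blinfun_exp_def blinfun.scaleR_left)

lemma blinfun_exp_zero: "blinfun_exp (0 :: 'a::{real_normed_vector, complete_space} \<Rightarrow>\<^sub>L 'a) = id_blinfun"
proof -
  have *: "(1 / fact n) *\<^sub>R blinfun_pow (0::'a \<Rightarrow>\<^sub>L 'a) n = (if n = 0 then id_blinfun else 0)" for n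
    by (cases n) auto
  have "(\<lambda>n. (1 / fact n) *\<^sub>R blinfun_pow (0::'a \<Rightarrow>\<^sub>L 'a) n) sums id_blinfun"
    unfolding * by (rule sums_single)
  then show ?thesis by (simp add: blinfun_exp_def sums_iff)
qed

lemma blinfun_exp_commute:
  fixes X :: "'a::{real_normed_vector, complete_space} \<Rightarrow>\<^sub>L 'a"
  assumes "\<And>x. blinfun_apply Y (X x) = X (Y x)"
  shows "blinfun_apply Y (blinfun_exp X x) = blinfun_exp X (Y x)"
proof -
  have "(\<lambda>n. (1 / fact n) *\<^sub>R blinfun_pow X n (Y x)) sums Y (blinfun_exp X x)"
    using bounded_linear.sums[OF blinfun.bounded_linear_right blinfun_exp_sums_apply, of Y X x]
    by (simp add: blinfun.scaleR_right blinfun_pow_commute[of Y X, OF assms])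
  from sums_unique2[OF this blinfun_exp_sums_apply] show ?thesis .
qed

lemma norm_blinfun_exp:
  fixes X :: "'a::{real_normed_vector, complete_space} \<Rightarrow>\<^sub>L 'a"
  shows "norm (blinfun_exp X) \<le> exp (norm X)"
proof -
  have "(\<lambda>m. norm (\<Sum>n<m. (1 / fact n) *\<^sub>R blinfun_pow X n)) \<longlonglongrightarrow> norm (blinfun_exp X)"
    unfolding blinfun_exp_def by (intro tendsto_norm summable_LIMSEQ summable_blinfun_exp)
  moreover have "(\<lambda>m. \<Sum>n<m. norm X ^ n /\<^sub>R fact n) \<longlonglongrightarrow> exp (norm X)"
    using exp_converges[of "norm X"] by (simp add: sums_def)
  moreover have "norm (\<Sum>n<m. (1 / fact n) *\<^sub>R blinfun_pow X n) \<le> (\<Sum>n<m. norm X ^ n /\<^sub>R fact n)" for m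
    by (rule sum_norm_le) (simp add: norm_blinfun_pow field_simps)
  ultimately show ?thesis by (meson LIMSEQ_le)
qed

text \<open>From second order on, the binomial coefficients are nonnegative, so the triangle
  inequality replaces \<open>s\<close> and \<open>h\<close> by their absolute values.\<close>

lemma abs_power_remainder:
  fixes s h :: real
  shows "\<bar>(s + h) ^ n - s ^ n - of_nat n * h * s ^ (n - 1)\<bar>
    \<le> (\<bar>s\<bar> + \<bar>h\<bar>) ^ n - \<bar>s\<bar> ^ n - of_nat n * \<bar>h\<bar> * \<bar>s\<bar> ^ (n - 1)"
proof (cases n)
  case (Suc k)
  have split: "(a + b) ^ n - a ^ n - of_nat n * b * a ^ (n - 1)
      = (\<Sum>i=2..n. of_nat (n choose i) * b ^ i * a ^ (n - i))" for a b :: real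
  proof -
    have "(a + b) ^ n = (\<Sum>i\<le>n. of_nat (n choose i) * b ^ i * a ^ (n - i))"
      using binomial_ring[of b a n] by (simp add: add.commute)
    also have "{..n} = insert 0 (insert 1 {2..n})" using Suc by auto
    finally show ?thesis by simp
  qed
  have "\<bar>\<Sum>i=2..n. of_nat (n choose i) * h ^ i * s ^ (n - i)\<bar>
      \<le> (\<Sum>i=2..n. of_nat (n choose i) * \<bar>h\<bar> ^ i * \<bar>s\<bar> ^ (n - i))"
    by (rule order_trans[OF sum_abs]) (simp add: abs_mult power_abs)
  then show ?thesis unfolding split .
qed simp

text \<open>The series of the first-order remainder is dominated term by term by that of the real
  exponential with \<open>norm X\<close> in place of \<open>X\<close>, so differentiability is
  inherited from the real case.\<close>

lemma blinfun_exp_has_vector_derivative: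
  fixes X :: "'a::{real_normed_vector, complete_space} \<Rightarrow>\<^sub>L 'a"
  shows "((\<lambda>s. blinfun_exp (s *\<^sub>R X)) has_vector_derivative (X o\<^sub>L blinfun_exp (s *\<^sub>R X))) (at s)"
proof -
  let ?x = "norm X"
  define r where "r h = exp ((\<bar>s\<bar> + \<bar>h\<bar>) * ?x) - exp (\<bar>s\<bar> * ?x) - \<bar>h\<bar> * (?x * exp (\<bar>s\<bar> * ?x))" for h
  have rem: "norm (blinfun_exp ((s + h) *\<^sub>R X) - blinfun_exp (s *\<^sub>R X) - h *\<^sub>R (X o\<^sub>L blinfun_exp (s *\<^sub>R X))) \<le> r h" for h
  proof -
    \<comment> \<open>The differentiated series has a zero term at \<open>n = 0\<close>; shifted by
      one index it is \<open>X\<close> times the exponential series.\<close>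
    have d: "(\<lambda>n. (of_nat n * u ^ (n - 1) / fact n) *\<^sub>R blinfun_pow X n) sums (X o\<^sub>L blinfun_exp (u *\<^sub>R X))" for u
    proof -
      have "(\<lambda>n. X o\<^sub>L ((u ^ n / fact n) *\<^sub>R blinfun_pow X n)) sums (X o\<^sub>L blinfun_exp (u *\<^sub>R X))"
        by (rule bounded_linear.sums[OF bounded_bilinear.bounded_linear_right[OF bounded_bilinear_blinfun_compose] blinfun_exp_sums])
      moreover have "X o\<^sub>L ((u ^ n / fact n) *\<^sub>R blinfun_pow X n)
          = (of_nat (Suc n) * u ^ (Suc n - 1) / fact (Suc n)) *\<^sub>R blinfun_pow X (Suc n)" for n
        by (auto intro!: blinfun_eqI simp: blinfun.scaleR_left blinfun.scaleR_right field_simps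
            simp del: of_nat_Suc)
      ultimately have "(\<lambda>n. (of_nat (Suc n) * u ^ (Suc n - 1) / fact (Suc n)) *\<^sub>R blinfun_pow X (Suc n))
          sums (X o\<^sub>L blinfun_exp (u *\<^sub>R X))" by simp
      from sums_Suc[OF this] show ?thesis by simp
    qed
    have dr: "(\<lambda>n. (of_nat n * u ^ (n - 1) / fact n) * ?x ^ n) sums (?x * exp (u * ?x))" for u :: real
    proof -
      have "(\<lambda>n. ?x * ((u * ?x) ^ n /\<^sub>R fact n)) sums (?x * exp (u * ?x))"
        by (intro sums_mult exp_converges)
      moreover have "?x * ((u * ?x) ^ n /\<^sub>R fact n)
          = (of_nat (Suc n) * u ^ (Suc n - 1) / fact (Suc n)) * ?x ^ Suc n" for n
        by (simp add: field_simps del: of_nat_Suc)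
      ultimately have "(\<lambda>n. (of_nat (Suc n) * u ^ (Suc n - 1) / fact (Suc n)) * ?x ^ Suc n)
          sums (?x * exp (u * ?x))" by simp
      from sums_Suc[OF this] show ?thesis by simp
    qed
    have er: "(\<lambda>n. u ^ n / fact n * ?x ^ n) sums exp (u * ?x)" for u :: real
      using exp_converges[of "u * ?x"] by (simp add: field_simps)
    have 1: "(\<lambda>n. (((s + h) ^ n - s ^ n - of_nat n * h * s ^ (n - 1)) / fact n) *\<^sub>R blinfun_pow X n)
       sums (blinfun_exp ((s + h) *\<^sub>R X) - blinfun_exp (s *\<^sub>R X) - h *\<^sub>R (X o\<^sub>L blinfun_exp (s *\<^sub>R X)))"
      using sums_diff[OF sums_diff[OF blinfun_exp_sums[of "s + h" X] blinfun_exp_sums[of s X]]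
          sums_scaleR_right[OF d[of s], of h]]
      by (simp add: diff_divide_distrib scaleR_diff_left mult_ac)
    have 2: "(\<lambda>n. (((\<bar>s\<bar> + \<bar>h\<bar>) ^ n - \<bar>s\<bar> ^ n - of_nat n * \<bar>h\<bar> * \<bar>s\<bar> ^ (n - 1)) / fact n) * ?x ^ n) sums r h"
      using sums_diff[OF sums_diff[OF er[of "\<bar>s\<bar> + \<bar>h\<bar>"] er[of "\<bar>s\<bar>"]] sums_mult[OF dr[of "\<bar>s\<bar>"], of "\<bar>h\<bar>"]]
      unfolding r_def by (simp add: diff_divide_distrib left_diff_distrib mult.assoc
          mult.left_commute[of "\<bar>h\<bar>" "of_nat n" for n])
    have "norm (\<Sum>n<m. (((s + h) ^ n - s ^ n - of_nat n * h * s ^ (n - 1)) / fact n) *\<^sub>R blinfun_pow X n)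
        \<le> (\<Sum>n<m. (((\<bar>s\<bar> + \<bar>h\<bar>) ^ n - \<bar>s\<bar> ^ n - of_nat n * \<bar>h\<bar> * \<bar>s\<bar> ^ (n - 1)) / fact n) * ?x ^ n)" for m
    proof (rule sum_norm_le)
      fix n
      show "norm ((((s + h) ^ n - s ^ n - of_nat n * h * s ^ (n - 1)) / fact n) *\<^sub>R blinfun_pow X n)
        \<le> (((\<bar>s\<bar> + \<bar>h\<bar>) ^ n - \<bar>s\<bar> ^ n - of_nat n * \<bar>h\<bar> * \<bar>s\<bar> ^ (n - 1)) / fact n) * ?x ^ n"
      proof -
        note rem = abs_power_remainder[of s h n]
        have "0 \<le> (\<bar>s\<bar> + \<bar>h\<bar>) ^ n - \<bar>s\<bar> ^ n - of_nat n * \<bar>h\<bar> * \<bar>s\<bar> ^ (n - 1)"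
          by (rule order_trans[OF abs_ge_zero rem])
        then have "0 \<le> ((\<bar>s\<bar> + \<bar>h\<bar>) ^ n - \<bar>s\<bar> ^ n - of_nat n * \<bar>h\<bar> * \<bar>s\<bar> ^ (n - 1)) / fact n"
          by (rule divide_nonneg_nonneg[OF _ fact_ge_zero])
        with divide_right_mono[OF rem fact_ge_zero] show ?thesis
          unfolding norm_scaleR abs_divide abs_of_pos[OF fact_gt_zero]
          by (rule mult_mono[OF _ norm_blinfun_pow _ norm_ge_zero])
      qed
    qed
    with 1 2 show ?thesis
      unfolding sums_def by (intro LIMSEQ_le[OF tendsto_norm]) auto
  qed
  \<comment> \<open>The majorant depends on \<open>h\<close> only through its absolute value, so the
    real derivative is taken in that variable and then composed with the absolute value.\<close>
  have "((\<lambda>u. exp ((\<bar>s\<bar> + u) * ?x)) has_real_derivative ?x * exp (\<bar>s\<bar> * ?x)) (at 0)"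
    by (auto intro!: derivative_eq_intros)
  then have "(\<lambda>u. ((exp ((\<bar>s\<bar> + u) * ?x) - exp (\<bar>s\<bar> * ?x)) / u - ?x * exp (\<bar>s\<bar> * ?x))) \<midarrow>0\<rightarrow> 0"
    by (simp add: DERIV_def LIM_zero_iff)
  moreover have "LIM h at (0::real). \<bar>h\<bar> :> at 0"
    by (rule filterlim_atI) (auto intro!: tendsto_eq_intros simp: eventually_at_filter)
  ultimately have "(\<lambda>h. ((exp ((\<bar>s\<bar> + \<bar>h\<bar>) * ?x) - exp (\<bar>s\<bar> * ?x)) / \<bar>h\<bar> - ?x * exp (\<bar>s\<bar> * ?x))) \<midarrow>0\<rightarrow> 0"
    by (rule filterlim_compose)
  then have lim: "(\<lambda>h. r h / \<bar>h\<bar>) \<midarrow>0\<rightarrow> 0"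
    by (rule Lim_transform_eventually) (auto simp: eventually_at_filter r_def diff_divide_distrib)
  show ?thesis
    unfolding has_vector_derivative_def has_derivative_at
  proof (intro conjI bounded_linear_scaleR_left)
    show "(\<lambda>h. norm (blinfun_exp ((s + h) *\<^sub>R X) - blinfun_exp (s *\<^sub>R X) - h *\<^sub>R (X o\<^sub>L blinfun_exp (s *\<^sub>R X))) / norm h) \<midarrow>0\<rightarrow> 0"
      using rem by (intro Lim_null_comparison[OF _ lim]) (auto simp: divide_right_mono)
  qed
qed

lemma sgrp_has_vector_derivative:
  fixes X :: "'a::{real_normed_vector, complete_space} \<Rightarrow>\<^sub>L 'a"
  assumes "(u has_vector_derivative u') (at s)"
  shows "((\<lambda>s. blinfun_exp (s *\<^sub>R X) (u s)) has_vector_derivative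
           X (blinfun_exp (s *\<^sub>R X) (u s)) + blinfun_exp (s *\<^sub>R X) u') (at s)"
  using bounded_bilinear.has_vector_derivative[OF bounded_bilinear_blinfun_apply
      blinfun_exp_has_vector_derivative assms]
  by (simp add: add.commute)

lemma exp_flow_derivative:
  fixes X :: "'a::{real_normed_vector, complete_space} \<Rightarrow>\<^sub>L 'a"
  shows "((\<lambda>s. blinfun_exp ((- s) *\<^sub>R X) z) has_vector_derivative - X (blinfun_exp ((- s) *\<^sub>R X) z)) (at s)"
proof -
  have "((\<lambda>s. blinfun_exp (s *\<^sub>R (- X)) z) has_vector_derivative (- X) (blinfun_exp (s *\<^sub>R (- X)) z)) (at s)"
    using sgrp_has_vector_derivative[OF has_vector_derivative_const, of "- X"] by simp
  then show ?thesis by (simp add: blinfun.minus_left)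
qed

text \<open>A product rule in which both the operator, run back from time \<open>t\<close>, and its
  argument move. It serves the interpolations between two flows.\<close>

lemma exp_flow_derivative_rev:
  fixes X :: "'a::{real_normed_vector, complete_space} \<Rightarrow>\<^sub>L 'a"
  assumes "(u has_vector_derivative u') (at s)"
  shows "((\<lambda>s. blinfun_exp ((s - t) *\<^sub>R X) (u s)) has_vector_derivative
           X (blinfun_exp ((s - t) *\<^sub>R X) (u s)) + blinfun_exp ((s - t) *\<^sub>R X) u') (at s)"
proof -
  have "((\<lambda>s. blinfun_exp ((s - t) *\<^sub>R X)) has_vector_derivative (X o\<^sub>L blinfun_exp ((s - t) *\<^sub>R X))) (at s)"
  proof -
    have "((\<lambda>s. s - t) has_vector_derivative 1) (at s)" by (auto intro!: derivative_eq_intros)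
    from vector_diff_chain_at[OF this blinfun_exp_has_vector_derivative[of X]]
    show ?thesis by (simp add: o_def)
  qed
  from bounded_bilinear.has_vector_derivative[OF bounded_bilinear_blinfun_apply this assms]
  show ?thesis by (simp add: add.commute)
qed

text \<open>Duhamel's formula: the derivative of \<open>exp ((s - t) X) exp (- s Y) z\<close>
  contains \<open>X z - Y z\<close>, since everything commutes. As only this vector enters, and not
  \<open>norm (X - Y)\<close>, strong convergence of generators passes to their
  exponentials.\<close>

lemma exp_flow_diff_bound:
  fixes X Y :: "'a::{real_normed_vector, complete_space} \<Rightarrow>\<^sub>L 'a"
  assumes comm: "\<And>x. X (Y x) = Y (X x)" and t: "0 \<le> t"
  shows "norm (blinfun_exp ((- t) *\<^sub>R X) z - blinfun_exp ((- t) *\<^sub>R Y) z)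
           \<le> t * exp (t * (norm X + norm Y)) * norm (X z - Y z)"
proof -
  let ?g = "\<lambda>s. blinfun_exp ((s - t) *\<^sub>R X) (blinfun_exp ((- s) *\<^sub>R Y) z)"
  let ?g' = "\<lambda>s. X (?g s) + blinfun_exp ((s - t) *\<^sub>R X) (- Y (blinfun_exp ((- s) *\<^sub>R Y) z))"
  have XeY: "X (blinfun_exp (r *\<^sub>R Y) w) = blinfun_exp (r *\<^sub>R Y) (X w)" for r w
    by (rule blinfun_exp_commute) (simp add: blinfun.scaleR_left blinfun.scaleR_right comm)
  have YeY: "Y (blinfun_exp (r *\<^sub>R Y) w) = blinfun_exp (r *\<^sub>R Y) (Y w)" for r w
    by (rule blinfun_exp_commute) (simp add: blinfun.scaleR_left blinfun.scaleR_right)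
  have XeX: "X (blinfun_exp (r *\<^sub>R X) w) = blinfun_exp (r *\<^sub>R X) (X w)" for r w
    by (rule blinfun_exp_commute) (simp add: blinfun.scaleR_left blinfun.scaleR_right)
  have der: "(?g has_vector_derivative ?g' s) (at s)" for s
    by (rule exp_flow_derivative_rev[OF exp_flow_derivative])
  have g': "?g' s = blinfun_exp ((s - t) *\<^sub>R X) (blinfun_exp ((- s) *\<^sub>R Y) (X z - Y z))" for s
    by (simp only: XeX XeY YeY) (simp add: blinfun.bilinear_simps)
  have "norm (?g' s) \<le> exp (t * (norm X + norm Y)) * norm (X z - Y z)" if "s \<in> {0..t}" for s
  proof -
    have "norm (?g' s) \<le> norm (blinfun_exp ((s - t) *\<^sub>R X)) * (norm (blinfun_exp ((- s) *\<^sub>R Y)) * norm (X z - Y z))"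
      unfolding g' by (intro order_trans[OF norm_blinfun] mult_left_mono norm_blinfun norm_ge_zero)
    also have "\<dots> \<le> exp (t * norm X) * (exp (t * norm Y) * norm (X z - Y z))"
    proof (intro mult_mono)
      show "norm (blinfun_exp ((s - t) *\<^sub>R X)) \<le> exp (t * norm X)"
        using that by (intro order_trans[OF norm_blinfun_exp]) (auto intro: mult_right_mono)
      show "norm (blinfun_exp ((- s) *\<^sub>R Y)) \<le> exp (t * norm Y)"
        using that by (intro order_trans[OF norm_blinfun_exp]) (auto intro: mult_right_mono)
    qed auto
    finally show ?thesis by (simp add: distrib_left exp_add)
  qed
  then have "norm (?g t - ?g 0) \<le> exp (t * (norm X + norm Y)) * norm (X z - Y z) * norm (t - 0)"
    using t has_vector_derivative_at_within[OF der]
    by (intro differentiable_bound[of "{0..t}" ?g "\<lambda>s h. h *\<^sub>R ?g' s"])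
       (auto simp: has_vector_derivative_def onorm_scaleR_left onorm_id intro!: onorm_le)
  then show ?thesis using t
    by (simp add: blinfun_exp_zero norm_minus_commute mult_ac)
qed

subsection \<open>Adjoints\<close>

text \<open>The representing vector is the minimiser of \<open>J\<close>. By the parallelogram law a
  minimising sequence is Cauchy, and the first variation at its limit vanishes.\<close>

lemma riesz:
  fixes f :: "'a::{real_inner, complete_space} \<Rightarrow>\<^sub>L real"
  shows "\<exists>m. \<forall>x. f x = x \<bullet> m"
proof -
  define J where "J x = (norm x)\<^sup>2 - 2 * f x" for x
  have low: "- (norm f)\<^sup>2 \<le> J x" for x
  proof -
    have "f x \<le> norm f * norm x" using norm_blinfun[of f x] by simp
    moreover have "0 \<le> (norm x - norm f)\<^sup>2" by simp
    moreover have "(norm x - norm f)\<^sup>2 = (norm x)\<^sup>2 - 2 * (norm f * norm x) + (norm f)\<^sup>2"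
      by (simp add: power2_diff)
    ultimately show ?thesis unfolding J_def by linarith
  qed
  define d where "d = (INF x. J x)"
  have d: "d \<le> J x" for x
    unfolding d_def by (rule cINF_lower) (auto intro!: bdd_belowI2 low)
  have "\<exists>x. J x < d + 1 / Suc n" for n
  proof -
    have "bdd_below (range J)" using low by (rule bdd_belowI2)
    then show ?thesis
      using cINF_less_iff[of UNIV J "d + 1 / Suc n"] unfolding d_def by auto
  qed
  then obtain x where x: "\<And>n. J (x n) < d + 1 / Suc n" by metis
  have par: "(norm (u - v))\<^sup>2 \<le> 2 * J u + 2 * J v - 4 * d" for u v
  proof -
    have "(norm (u - v))\<^sup>2 = 2 * (norm u)\<^sup>2 + 2 * (norm v)\<^sup>2 - (norm (u + v))\<^sup>2"
      unfolding power2_norm_eq_inner by (simp add: inner_simps)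
    moreover have "J ((1/2) *\<^sub>R (u + v)) = (norm (u + v))\<^sup>2 / 4 - (f u + f v)"
      unfolding J_def norm_scaleR blinfun.scaleR_right blinfun.add_right power_mult_distrib
      by (simp add: power_divide field_simps)
    ultimately have "(norm (u - v))\<^sup>2 = 2 * J u + 2 * J v - 4 * J ((1/2) *\<^sub>R (u + v))"
      unfolding J_def[of u] J_def[of v] by simp
    then show ?thesis using d[of "(1/2) *\<^sub>R (u + v)"] by simp
  qed
  have small: "(norm (x m - x n))\<^sup>2 \<le> 4 / Suc N" if "m \<ge> N" "n \<ge> N" for m n N
  proof -
    have "1 / real (Suc m) \<le> 1 / Suc N" "1 / real (Suc n) \<le> 1 / Suc N"
      using that by (auto intro!: divide_left_mono)
    then show ?thesis using par[of "x m" "x n"] x[of m] x[of n] by linarith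
  qed
  have "Cauchy x"
  proof (rule CauchyI)
    fix e :: real assume "e > 0"
    then obtain N where N: "4 / e\<^sup>2 < real N" using reals_Archimedean2 by blast
    have "norm (x m - x n) < e" if "m \<ge> N" "n \<ge> N" for m n
    proof -
      have "4 / real (Suc N) < e\<^sup>2" using N \<open>e > 0\<close> by (simp add: field_simps) (smt (verit) zero_less_power)
      with small[OF that] have "(norm (x m - x n))\<^sup>2 < e\<^sup>2" by linarith
      then show ?thesis using \<open>e > 0\<close> by (simp add: power_less_imp_less_base)
    qed
    then show "\<exists>N. \<forall>m\<ge>N. \<forall>n\<ge>N. norm (x m - x n) < e" by blast
  qed
  then obtain m where m: "x \<longlonglongrightarrow> m" using Cauchy_convergent convergent_def by blast
  have Jm: "J m \<le> d"
  proof (rule LIMSEQ_le)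
    show "(\<lambda>n. J (x n)) \<longlonglongrightarrow> J m" unfolding J_def by (intro tendsto_intros m)
    show "(\<lambda>n. d + 1 / Suc n) \<longlonglongrightarrow> d"
      using tendsto_add[OF tendsto_const LIMSEQ_Suc[OF lim_inverse_n'], of d] by simp
  qed (use x less_imp_le in blast)
  have "f v = v \<bullet> m" for v
  proof -
    have q: "0 \<le> 2 * (m \<bullet> v - f v) * r + (norm v)\<^sup>2 * r\<^sup>2" for r
    proof -
      have "J (m + r *\<^sub>R v) = J m + 2 * (m \<bullet> v - f v) * r + (norm v)\<^sup>2 * r\<^sup>2"
        unfolding J_def power2_norm_eq_inner
        by (simp add: inner_simps blinfun.bilinear_simps inner_commute[of v m] algebra_simps power2_eq_square)
      then show ?thesis using d[of "m + r *\<^sub>R v"] Jm by linarith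
    qed
    \<comment> \<open>If \<open>p\<close> were nonzero, the quadratic \<open>q\<close> would be
      negative at its approximate minimiser \<open>- p / D\<close>; the added 1 keeps
      \<open>D\<close> positive for \<open>v = 0\<close>.\<close>
    define p where "p = m \<bullet> v - f v"
    have "p = 0"
    proof (rule ccontr)
      assume "p \<noteq> 0"
      define D where "D = (norm v)\<^sup>2 + 1"
      have D: "D > 0" unfolding D_def by (smt (verit) zero_le_power2)
      define r where "r = - p / D"
      have "2 * p * r + (D - 1) * r\<^sup>2 = - (p\<^sup>2 / D) - p\<^sup>2 / D\<^sup>2"
        unfolding r_def using D by (simp add: field_simps power2_eq_square)
      also have "\<dots> < 0"
        using D \<open>p \<noteq> 0\<close> by (smt (verit) divide_pos_pos zero_less_power2)
      finally show False using q[of r] by (simp add: p_def D_def)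
    qed
    then show ?thesis by (simp add: p_def inner_commute)
  qed
  then show ?thesis by blast
qed

lemma adjoint_exists:
  fixes X :: "'a::{real_inner, complete_space} \<Rightarrow>\<^sub>L 'a"
  shows "\<exists>Y :: 'a \<Rightarrow>\<^sub>L 'a. \<forall>u w. X u \<bullet> w = u \<bullet> Y w"
proof -
  have "\<exists>m. \<forall>u. X u \<bullet> w = u \<bullet> m" for w
  proof -
    have "bounded_linear (\<lambda>u. X u \<bullet> w)"
      using bounded_linear_compose[OF bounded_linear_inner_left blinfun.bounded_linear_right] .
    from riesz[of "Blinfun (\<lambda>u. X u \<bullet> w)"] show ?thesis
      by (simp add: bounded_linear_Blinfun_apply[OF \<open>bounded_linear _\<close>])
  qed
  then obtain g where g: "\<And>w u. X u \<bullet> w = u \<bullet> g w" by metis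
  have "bounded_linear g"
  proof (rule bounded_linear_intro)
    show "g (x + y) = g x + g y" for x y
      by (rule vector_eq_ldot[THEN iffD1]) (simp add: g[symmetric] inner_add_right)
    show "g (r *\<^sub>R x) = r *\<^sub>R g x" for r x
      by (rule vector_eq_ldot[THEN iffD1]) (simp add: g[symmetric])
    show "norm (g x) \<le> norm x * norm X" for x
    proof (cases "g x = 0")
      case False
      have "norm (g x) * norm (g x) = X (g x) \<bullet> x"
        by (simp add: g power2_norm_eq_inner[symmetric] power2_eq_square)
      also have "\<dots> \<le> norm (X (g x)) * norm x" by (rule norm_cauchy_schwarz)
      also have "\<dots> \<le> (norm X * norm (g x)) * norm x" by (intro mult_right_mono norm_blinfun) auto
      finally show ?thesis using False by (simp add: mult_ac)
    qed simp
  qed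
  then show ?thesis using g by (intro exI[of _ "Blinfun g"]) (simp add: bounded_linear_Blinfun_apply)
qed

lemma adjoint_pow:
  fixes X Y :: "'a::real_inner \<Rightarrow>\<^sub>L 'a"
  assumes adj: "\<And>u w. blinfun_apply X u \<bullet> w = u \<bullet> blinfun_apply Y w"
  shows "blinfun_pow X n u \<bullet> w = u \<bullet> blinfun_pow Y n w"
proof (induction n arbitrary: u w)
  case (Suc n)
  then show ?case using blinfun_pow_Suc_right[of Y n w] by (simp add: adj)
qed simp

text \<open>Testing with \<open>u = Y w\<close> and Cauchy-Schwarz. In this way the adjoint inherits
  the power bound \<open>K\<close>.\<close>

lemma adjoint_bound:
  fixes X Y :: "'a::real_inner \<Rightarrow>\<^sub>L 'a"
  assumes adj: "\<And>u w. blinfun_apply X u \<bullet> w = u \<bullet> blinfun_apply Y w"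
    and X: "\<And>z. norm (X z) \<le> K * norm z"
  shows "norm (Y w) \<le> K * norm w"
proof (cases "Y w = 0")
  case True
  have "0 \<le> K * norm w" by (rule order_trans[OF norm_ge_zero X])
  with True show ?thesis by simp
next
  case False
  have "norm (Y w) * norm (Y w) = X (Y w) \<bullet> w"
    by (simp add: adj power2_norm_eq_inner[symmetric] power2_eq_square)
  also have "\<dots> \<le> norm (X (Y w)) * norm w" by (rule norm_cauchy_schwarz)
  also have "\<dots> \<le> (K * norm (Y w)) * norm w" by (intro mult_right_mono X) auto
  finally show ?thesis using False by (simp add: mult_ac)
qed

lemma exp_adjoint:
  fixes X Y :: "'a::{real_inner, complete_space} \<Rightarrow>\<^sub>L 'a"
  assumes adj: "\<And>u w. X u \<bullet> w = u \<bullet> Y w"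
  shows "blinfun_exp (s *\<^sub>R X) u \<bullet> w = u \<bullet> blinfun_exp (s *\<^sub>R Y) w"
proof -
  have adj_s: "(s *\<^sub>R X) u \<bullet> w = u \<bullet> (s *\<^sub>R Y) w" for u w
    by (simp add: blinfun.scaleR_left adj)
  have "(\<lambda>n. ((1 / fact n) *\<^sub>R blinfun_pow (s *\<^sub>R X) n u) \<bullet> w) sums (blinfun_exp (s *\<^sub>R X) u \<bullet> w)"
    by (rule bounded_linear.sums[OF bounded_linear_inner_left blinfun_exp_sums_apply])
  moreover have "(\<lambda>n. u \<bullet> ((1 / fact n) *\<^sub>R blinfun_pow (s *\<^sub>R Y) n w)) sums (u \<bullet> blinfun_exp (s *\<^sub>R Y) w)"
    by (rule bounded_linear.sums[OF bounded_linear_inner_right blinfun_exp_sums_apply])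
  ultimately show ?thesis
    using sums_unique2 by (simp add: adjoint_pow[OF adj_s])
qed

subsection \<open>Energy estimates for power-bounded operators\<close>

text \<open>With \<open>P = T h\<close> and \<open>q = (1 / (1 + a * h))\<^sup>2\<close>,
  \<open>h\<close> times this sum is a polarised Riemann sum for the integral \<open>V\<close>, when
  \<open>h\<close> is small and \<open>N\<close> large. Truncation at \<open>N\<close> avoids
  questions of convergence, and the two arguments allow the derivative along a flow to be written
  down.\<close>

definition energy :: "('a::real_inner \<Rightarrow>\<^sub>L 'a) \<Rightarrow> real \<Rightarrow> nat \<Rightarrow> 'a \<Rightarrow> 'a \<Rightarrow> real" where
  "energy P q N u w = (\<Sum>n<N. q ^ n * (blinfun_pow P n u \<bullet> blinfun_pow P n w))"

lemma energy_nonneg: "0 \<le> q \<Longrightarrow> 0 \<le> energy P q N u u"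
  unfolding energy_def by (intro sum_nonneg mult_nonneg_nonneg) auto

lemma energy_commute: "energy P q N u w = energy P q N w u"
  by (simp add: energy_def inner_commute)

lemma energy_scaleR_right: "energy P q N u (r *\<^sub>R w) = r * energy P q N u w"
  by (simp add: energy_def blinfun.scaleR_right sum_distrib_left mult_ac)

lemma energy_minus_right: "energy P q N u (- w) = - energy P q N u w"
  using energy_scaleR_right[of P q N u "-1" w] by simp

lemma energy_diff_right: "energy P q N u (v - w) = energy P q N u v - energy P q N u w"
  by (simp add: energy_def blinfun.diff_right inner_diff_right right_diff_distrib sum_subtractf)

lemma energy_le_norm:
  assumes pow: "\<And>n z. norm (blinfun_pow P n z) \<le> K * norm z" and q: "0 \<le> q" "q < 1"
  shows "energy P q N z z \<le> K\<^sup>2 * (norm z)\<^sup>2 / (1 - q)"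
proof -
  have "energy P q N z z \<le> (\<Sum>n<N. q ^ n * (K\<^sup>2 * (norm z)\<^sup>2))"
    unfolding energy_def
  proof (intro sum_mono mult_left_mono)
    show "blinfun_pow P n z \<bullet> blinfun_pow P n z \<le> K\<^sup>2 * (norm z)\<^sup>2" for n
      using power_mono[OF pow[of n z] norm_ge_zero, of 2]
      by (simp add: power2_norm_eq_inner[symmetric] power_mult_distrib)
  qed (use q in auto)
  also have "\<dots> = (1 - q ^ N) / (1 - q) * (K\<^sup>2 * (norm z)\<^sup>2)"
    using q by (simp add: sum_distrib_right[symmetric] sum_gp_strict)
  also have "\<dots> \<le> 1 / (1 - q) * (K\<^sup>2 * (norm z)\<^sup>2)"
    using q by (intro mult_right_mono divide_right_mono) auto
  finally show ?thesis by simp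
qed

lemma energy_has_derivative:
  assumes "(u has_vector_derivative u') (at s)"
  shows "((\<lambda>s. energy P q N (u s) (u s)) has_real_derivative 2 * energy P q N (u s) u') (at s)"
proof -
  have P: "((\<lambda>s. blinfun_pow P n (u s)) has_vector_derivative blinfun_pow P n u') (at s)" for n
    by (rule bounded_linear.has_vector_derivative[OF blinfun.bounded_linear_right assms])
  have "((\<lambda>s. blinfun_pow P n (u s) \<bullet> blinfun_pow P n (u s)) has_real_derivative
      2 * (blinfun_pow P n (u s) \<bullet> blinfun_pow P n u')) (at s)" for n
    using bounded_bilinear.has_vector_derivative[OF bounded_bilinear_inner P P, of n n]
    by (simp add: has_real_derivative_iff_has_vector_derivative inner_commute)
  from DERIV_sum[of "{..<N}", OF DERIV_cmult[OF this, where c = "q ^ n" for n]]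
  show ?thesis unfolding energy_def by (simp add: sum_distrib_left mult_ac)
qed

text \<open>A discrete Lyapunov identity: applying \<open>\<sigma> P\<close> shifts the summation
  index, so the difference telescopes and only the two end terms survive.\<close>

lemma energy_shift:
  "energy P (\<sigma>\<^sup>2) N v v - energy P (\<sigma>\<^sup>2) N (\<sigma> *\<^sub>R P v) (\<sigma> *\<^sub>R P v)
     = (norm v)\<^sup>2 - (\<sigma>\<^sup>2) ^ N * (norm (blinfun_pow P N v))\<^sup>2"
proof -
  define f where "f n = (\<sigma>\<^sup>2) ^ n * (norm (blinfun_pow P n v))\<^sup>2" for n
  have "energy P (\<sigma>\<^sup>2) N v v = (\<Sum>n<N. f n)"
    by (simp add: energy_def f_def power2_norm_eq_inner)
  moreover have "energy P (\<sigma>\<^sup>2) N (\<sigma> *\<^sub>R P v) (\<sigma> *\<^sub>R P v) = (\<Sum>n<N. f (Suc n))"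
    unfolding energy_def f_def blinfun_pow_Suc_right
    by (simp add: blinfun.scaleR_right power2_norm_eq_inner power2_eq_square[of \<sigma>] mult_ac)
  moreover have "(\<Sum>n<N. f n) - (\<Sum>n<N. f (Suc n)) = f 0 - f N"
    using sum_lessThan_telescope'[of f N] by (simp add: sum_subtractf)
  ultimately show ?thesis by (simp add: f_def)
qed

text \<open>The mixed term is at most the mean of the two diagonal energies, and their difference is
  given by \<open>energy_shift\<close>. The condition on \<open>N\<close> makes the truncation term
  consume at most half of the squared norm of \<open>v\<close>.\<close>

lemma energy_coercive:
  assumes pow: "\<And>n z. norm (blinfun_pow P n z) \<le> K * norm z"
    and r: "0 \<le> r" "r \<le> 1" and N: "(\<sigma>\<^sup>2) ^ N * K\<^sup>2 \<le> 1 / 2"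
  shows "r / 2 * (norm v)\<^sup>2 \<le> 2 * energy P (\<sigma>\<^sup>2) N v (v - (r * \<sigma>) *\<^sub>R P v)"
proof -
  let ?V = "energy P (\<sigma>\<^sup>2) N"
  let ?e = "\<sigma> *\<^sub>R P v"
  have pm: "2 * ?V v ?e \<le> ?V v v + ?V ?e ?e"
  proof -
    have "2 * (x \<bullet> y) \<le> x \<bullet> x + y \<bullet> y" for x y :: 'a
      using inner_ge_zero[of "x - y"] by (simp add: inner_simps inner_commute)
    from mult_left_mono[OF this, of "(\<sigma>\<^sup>2) ^ n" for n]
    have "(\<Sum>n<N. (\<sigma>\<^sup>2) ^ n * (2 * (blinfun_pow P n v \<bullet> blinfun_pow P n ?e)))
      \<le> (\<Sum>n<N. (\<sigma>\<^sup>2) ^ n * (blinfun_pow P n v \<bullet> blinfun_pow P n v + blinfun_pow P n ?e \<bullet> blinfun_pow P n ?e))"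
      by (intro sum_mono) simp
    then show ?thesis by (simp add: energy_def distrib_left sum.distrib sum_distrib_left mult_ac)
  qed
  have "(\<sigma>\<^sup>2) ^ N * (norm (blinfun_pow P N v))\<^sup>2 \<le> (\<sigma>\<^sup>2) ^ N * (K * norm v)\<^sup>2"
    by (intro mult_left_mono power_mono pow) auto
  also have "\<dots> = (\<sigma>\<^sup>2) ^ N * K\<^sup>2 * (norm v)\<^sup>2" by (simp add: power_mult_distrib)
  also have "\<dots> \<le> 1 / 2 * (norm v)\<^sup>2" by (intro mult_right_mono N) auto
  finally have sh: "(norm v)\<^sup>2 / 2 \<le> ?V v v - ?V ?e ?e"
    unfolding energy_shift by linarith
  have eq: "?V v (v - (r * \<sigma>) *\<^sub>R P v) = ?V v v - r * ?V v ?e"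
    by (simp add: energy_diff_right energy_scaleR_right)
  have "r * (2 * ?V v ?e) \<le> r * (?V v v + ?V ?e ?e)" by (intro mult_left_mono pm r)
  moreover have "r * ((norm v)\<^sup>2 / 2) \<le> r * (?V v v - ?V ?e ?e)" by (intro mult_left_mono sh r)
  moreover have "0 \<le> (1 - r) * ?V v v" using r by (intro mult_nonneg_nonneg energy_nonneg) auto
  ultimately show ?thesis unfolding eq by (simp add: algebra_simps)
qed

text \<open>\<open>X\<close> is the resolvent at \<open>a\<close> of the difference quotient \<open>(P - I) / h\<close>.\<close>

definition quot_resolvent :: "real \<Rightarrow> ('a::real_normed_vector \<Rightarrow>\<^sub>L 'a) \<Rightarrow> real \<Rightarrow> ('a \<Rightarrow>\<^sub>L 'a) \<Rightarrow> bool" where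
  "quot_resolvent h P a X \<longleftrightarrow>
     (\<forall>w. (1 + a * h) *\<^sub>R X w - P (X w) = h *\<^sub>R w) \<and>
     (\<forall>w. X ((1 + a * h) *\<^sub>R w - P w) = h *\<^sub>R w)"

lemma quot_resolvent_adjoint:
  fixes P P' X X' :: "'a::real_inner \<Rightarrow>\<^sub>L 'a"
  assumes "quot_resolvent h P a X"
    and P: "\<And>u w. P u \<bullet> w = u \<bullet> P' w" and X: "\<And>u w. X u \<bullet> w = u \<bullet> X' w"
  shows "quot_resolvent h P' a X'"
  unfolding quot_resolvent_def
proof (intro conjI allI)
  fix w
  show "(1 + a * h) *\<^sub>R X' w - P' (X' w) = h *\<^sub>R w"
  proof (rule vector_eq_ldot[THEN iffD1], rule allI)
    fix u
    have "u \<bullet> ((1 + a * h) *\<^sub>R X' w - P' (X' w)) = X ((1 + a * h) *\<^sub>R u - P u) \<bullet> w"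
      by (simp only: X) (simp add: inner_simps P)
    then show "u \<bullet> ((1 + a * h) *\<^sub>R X' w - P' (X' w)) = u \<bullet> (h *\<^sub>R w)"
      using assms(1) by (simp add: quot_resolvent_def)
  qed
  show "X' ((1 + a * h) *\<^sub>R w - P' w) = h *\<^sub>R w"
  proof (rule vector_eq_ldot[THEN iffD1], rule allI)
    fix u
    have "u \<bullet> X' ((1 + a * h) *\<^sub>R w - P' w) = ((1 + a * h) *\<^sub>R X u - P (X u)) \<bullet> w"
      by (simp only: X[symmetric]) (simp add: inner_simps P)
    then show "u \<bullet> X' ((1 + a * h) *\<^sub>R w - P' w) = u \<bullet> (h *\<^sub>R w)"
      using assms(1) by (simp add: quot_resolvent_def)
  qed
qed

lemma quot_resolvent_identity:
  assumes "quot_resolvent h P a X" "quot_resolvent h P b Y" "h > 0"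
  shows "X w - Y w = (b - a) *\<^sub>R X (Y w)"
proof -
  have "h *\<^sub>R X w = X ((1 + b * h) *\<^sub>R Y w - P (Y w))"
    using assms(2) by (simp add: quot_resolvent_def blinfun.scaleR_right)
  also have "\<dots> = X ((1 + a * h) *\<^sub>R Y w - P (Y w)) + ((b - a) * h) *\<^sub>R X (Y w)"
    by (simp add: blinfun.bilinear_simps algebra_simps)
  also have "\<dots> = h *\<^sub>R (Y w + (b - a) *\<^sub>R X (Y w))"
    using assms(1) by (simp add: quot_resolvent_def algebra_simps)
  finally show ?thesis using \<open>h > 0\<close> by simp
qed

text \<open>\<open>\<theta>\<close> is the discount per time step, a discrete
  \<open>exp (- a * h)\<close>; the quotient \<open>h * \<theta> / (1 - \<theta>)\<close>
  corresponds to the integral of \<open>exp (- a * s)\<close>.\<close>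

lemma discount_bounds:
  fixes a h :: real
  assumes "a > 0" "h > 0"
  defines "\<theta> \<equiv> 1 / (1 + a * h)"
  shows "0 < \<theta>" "\<theta> < 1" "h * \<theta> / (1 - \<theta>) = 1 / a" "h * \<theta> / (1 - \<theta>\<^sup>2) \<le> 1 / a"
proof -
  have ah: "0 < a * h" using assms by simp
  show t: "0 < \<theta>" "\<theta> < 1" unfolding \<theta>_def using ah by simp_all
  have "1 - \<theta> = a * h * \<theta>" unfolding \<theta>_def using ah by (simp add: field_simps)
  then show e: "h * \<theta> / (1 - \<theta>) = 1 / a" using assms(1,2) t by simp
  have "\<theta>\<^sup>2 \<le> \<theta>" using t by (simp add: power2_eq_square)
  then have "h * \<theta> / (1 - \<theta>\<^sup>2) \<le> h * \<theta> / (1 - \<theta>)"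
    using t assms(2) by (intro divide_left_mono mult_pos_pos) (auto simp: abs_square_less_1)
  then show "h * \<theta> / (1 - \<theta>\<^sup>2) \<le> 1 / a" using e by simp
qed

lemma discount_power_small:
  fixes q K :: real
  assumes "0 \<le> q" "q < 1"
  shows "\<exists>N. q ^ N * K\<^sup>2 \<le> 1 / 2"
proof -
  have "(\<lambda>N. q ^ N * K\<^sup>2) \<longlonglongrightarrow> 0 * K\<^sup>2"
    using assms by (intro tendsto_mult tendsto_const LIMSEQ_realpow_zero)
  then have "eventually (\<lambda>N. q ^ N * K\<^sup>2 < 1 / 2) sequentially"
    by (intro order_tendstoD) auto
  then show ?thesis using eventually_happens less_imp_le trivial_limit_sequentially by blast
qed

text \<open>By the resolvent equation \<open>X w - \<theta> P (X w)\<close> is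
  \<open>h * \<theta>\<close> times \<open>w\<close>, where \<open>\<theta> = r * \<sigma>\<close>,
  so coercivity applies to \<open>X w\<close>. Along \<open>u' = - X u\<close> this bounds the
  dissipation of the energy from below. The split of \<open>\<theta>\<close> selects the weights:
  \<open>r = 1\<close> gives \<open>\<theta> ^ (2 * n)\<close>, and
  \<open>r = \<sigma> = sqrt \<theta>\<close> gives \<open>\<theta> ^ n\<close>.\<close>

lemma quot_resolvent_coercive:
  assumes pow: "\<And>n z. norm (blinfun_pow P n z) \<le> K * norm z"
    and res: "quot_resolvent h P a X" and "a > 0" "h > 0"
    and "0 \<le> r" "r \<le> 1" and \<sigma>: "r * \<sigma> = 1 / (1 + a * h)" and N: "(\<sigma>\<^sup>2) ^ N * K\<^sup>2 \<le> 1 / 2"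
  shows "r / 2 * (norm (X w))\<^sup>2 \<le> 2 * (h * (r * \<sigma>)) * energy P (\<sigma>\<^sup>2) N (X w) w"
proof -
  have "1 + a * h \<noteq> 0" using \<open>a > 0\<close> \<open>h > 0\<close> by (smt (verit) mult_pos_pos)
  then have e: "(r * \<sigma>) * (1 + a * h) = 1" by (simp add: \<sigma>)
  have "(1 + a * h) *\<^sub>R X w - P (X w) = h *\<^sub>R w" using res by (simp add: quot_resolvent_def)
  then have "(r * \<sigma>) *\<^sub>R ((1 + a * h) *\<^sub>R X w - P (X w)) = (r * \<sigma>) *\<^sub>R (h *\<^sub>R w)" by simp
  then have "X w - (r * \<sigma>) *\<^sub>R P (X w) = (h * (r * \<sigma>)) *\<^sub>R w"
    by (simp only: scaleR_diff_right scaleR_scaleR e scaleR_one) (simp add: mult.commute)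
  then show ?thesis
    using energy_coercive[OF pow assms(5,6) N, of "X w"] by (simp add: energy_scaleR_right)
qed

text \<open>
  The function \<open>s \<mapsto> \<langle>exp (- s Y) z, exp (- (t - s) X*) y\<rangle>\<close> interpolates between the two flows. Its derivative is
  \<open>(b - a) \<langle>Y u, X* \<eta>\<rangle>\<close> by the resolvent identity, and both factors are dissipated by the energies.
\<close>

lemma flow_difference_bound:
  fixes P X Y :: "'a::{real_inner, complete_space} \<Rightarrow>\<^sub>L 'a"
  assumes pow: "\<And>n z. norm (blinfun_pow P n z) \<le> K * norm z"
    and res: "quot_resolvent h P a X" "quot_resolvent h P b Y"
    and pos: "a > 0" "b > 0" "h > 0" "\<epsilon> > 0" and t: "0 \<le> t"
    and v: "\<And>N. h / (1 + b * h) * energy P ((1 / (1 + b * h))\<^sup>2) N z z \<le> v"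
  shows "\<bar>(blinfun_exp ((- t) *\<^sub>R X) z - blinfun_exp ((- t) *\<^sub>R Y) z) \<bullet> y\<bar>
    \<le> \<bar>a - b\<bar> * (\<epsilon> * v + K\<^sup>2 * (norm y)\<^sup>2 / (a * \<epsilon>))"
proof -
  obtain P' X' :: "'a \<Rightarrow>\<^sub>L 'a" where P': "\<And>u w. P u \<bullet> w = u \<bullet> P' w" and X': "\<And>u w. X u \<bullet> w = u \<bullet> X' w"
    using adjoint_exists by metis
  have pow': "norm (blinfun_pow P' n w) \<le> K * norm w" for n w
    by (rule adjoint_bound[OF adjoint_pow[OF P'] pow])
  have res': "quot_resolvent h P' a X'" by (rule quot_resolvent_adjoint[OF res(1) P' X'])
  define \<theta>a \<theta>b where "\<theta>a = 1 / (1 + a * h)" and "\<theta>b = 1 / (1 + b * h)"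
  note da = discount_bounds[OF pos(1,3), folded \<theta>a_def]
  note db = discount_bounds[OF pos(2,3), folded \<theta>b_def]
  have sq: "\<theta>a\<^sup>2 < 1" "\<theta>b\<^sup>2 < 1" using da db by (auto simp: abs_square_less_1)
  obtain N M where N: "(\<theta>a\<^sup>2) ^ N * K\<^sup>2 \<le> 1 / 2" and M: "(\<theta>b\<^sup>2) ^ M * K\<^sup>2 \<le> 1 / 2"
    using discount_power_small sq by (metis zero_le_power2)
  have cY: "1 / 2 * (norm (Y w))\<^sup>2 \<le> 2 * (h * \<theta>b) * energy P (\<theta>b\<^sup>2) M (Y w) w" for w
    using quot_resolvent_coercive[OF pow res(2) pos(2,3), where r = 1 and \<sigma> = \<theta>b and N = M and w = w] M by (simp add: \<theta>b_def)
  have cX: "1 / 2 * (norm (X' w))\<^sup>2 \<le> 2 * (h * \<theta>a) * energy P' (\<theta>a\<^sup>2) N (X' w) w" for w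
    using quot_resolvent_coercive[OF pow' res' pos(1,3), where r = 1 and \<sigma> = \<theta>a and N = N and w = w] N by (simp add: \<theta>a_def)
  define u where "u s = blinfun_exp ((- s) *\<^sub>R Y) z" for s
  \<comment> \<open>The adjoint flow runs backwards and ends in \<open>y\<close> at
    \<open>s = t\<close>, so its energy grows with \<open>s\<close>.\<close>
  define \<eta> where "\<eta> s = blinfun_exp ((s - t) *\<^sub>R X') y" for s
  have du: "(u has_vector_derivative - Y (u s)) (at s)" for s
    unfolding u_def by (rule exp_flow_derivative)
  have d\<eta>: "(\<eta> has_vector_derivative X' (\<eta> s)) (at s)" for s
    using exp_flow_derivative_rev[OF has_vector_derivative_const[of y], where X = X' and t = t and s = s] by (simp add: \<eta>_def[abs_def])
  define g where "g s = u s \<bullet> \<eta> s" for s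
  define g' where "g' s = (b - a) * (Y (u s) \<bullet> X' (\<eta> s))" for s
  have dg: "(g has_real_derivative g' s) (at s)" for s
  proof -
    have "(g has_real_derivative (u s \<bullet> X' (\<eta> s) + (- Y (u s)) \<bullet> \<eta> s)) (at s)"
      unfolding has_real_derivative_iff_has_vector_derivative g_def
      by (rule bounded_bilinear.has_vector_derivative[OF bounded_bilinear_inner du d\<eta>])
    moreover have "u s \<bullet> X' (\<eta> s) + (- Y (u s)) \<bullet> \<eta> s = (X (u s) - Y (u s)) \<bullet> \<eta> s"
      by (simp add: X'[symmetric] inner_simps)
    ultimately show ?thesis
      by (simp add: g'_def quot_resolvent_identity[OF res pos(3)] X')
  qed
  \<comment> \<open>A potential whose decrease dominates the variation of \<open>g\<close>. The
    parameter \<open>\<epsilon>\<close> comes from Young's inequality, which separates the product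
    of the two dissipated norms.\<close>
  define \<Phi> where "\<Phi> s = \<bar>a - b\<bar> * (\<epsilon> * (h * \<theta>b * energy P (\<theta>b\<^sup>2) M (u s) (u s))
      - (h * \<theta>a * energy P' (\<theta>a\<^sup>2) N (\<eta> s) (\<eta> s)) / \<epsilon>)" for s
  define \<Phi>' where "\<Phi>' s = \<bar>a - b\<bar> * (\<epsilon> * (h * \<theta>b * (2 * energy P (\<theta>b\<^sup>2) M (u s) (- Y (u s))))
      - (h * \<theta>a * (2 * energy P' (\<theta>a\<^sup>2) N (\<eta> s) (X' (\<eta> s)))) / \<epsilon>)" for s
  have d\<Phi>: "(\<Phi> has_real_derivative \<Phi>' s) (at s)" for s
    unfolding \<Phi>_def \<Phi>'_def
    by (intro DERIV_cmult DERIV_diff DERIV_cdivide energy_has_derivative du d\<eta>)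
  have bd: "\<bar>g' s\<bar> + \<Phi>' s \<le> 0" for s
  proof -
    let ?A = "norm (Y (u s))" and ?B = "norm (X' (\<eta> s))"
    have amgm: "?A * ?B \<le> \<epsilon> / 2 * ?A\<^sup>2 + ?B\<^sup>2 / (2 * \<epsilon>)"
    proof -
      have "0 \<le> (\<epsilon> * ?A - ?B)\<^sup>2 / (2 * \<epsilon>)" using pos by simp
      also have "\<dots> = \<epsilon> / 2 * ?A\<^sup>2 + ?B\<^sup>2 / (2 * \<epsilon>) - ?A * ?B"
        using pos by (simp add: power2_eq_square field_simps)
      finally show ?thesis by simp
    qed
    have "\<bar>Y (u s) \<bullet> X' (\<eta> s)\<bar> \<le> ?A * ?B" by (rule Cauchy_Schwarz_ineq2)
    also note amgm
    also have "\<epsilon> / 2 * ?A\<^sup>2 + ?B\<^sup>2 / (2 * \<epsilon>)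
        \<le> \<epsilon> * (2 * (h * \<theta>b) * energy P (\<theta>b\<^sup>2) M (Y (u s)) (u s))
        + (2 * (h * \<theta>a) * energy P' (\<theta>a\<^sup>2) N (X' (\<eta> s)) (\<eta> s)) / \<epsilon>"
    proof -
      have "\<epsilon> / 2 * ?A\<^sup>2 = \<epsilon> * (1 / 2 * ?A\<^sup>2)" "?B\<^sup>2 / (2 * \<epsilon>) = (1 / 2 * ?B\<^sup>2) / \<epsilon>" by simp_all
      then show ?thesis
        using mult_left_mono[OF cY[of "u s"], of \<epsilon>] divide_right_mono[OF cX[of "\<eta> s"], of \<epsilon>] pos by linarith
    qed
    finally have "\<bar>b - a\<bar> * \<bar>Y (u s) \<bullet> X' (\<eta> s)\<bar> \<le> \<bar>b - a\<bar> * (\<epsilon> * (2 * (h * \<theta>b) * energy P (\<theta>b\<^sup>2) M (Y (u s)) (u s))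
        + (2 * (h * \<theta>a) * energy P' (\<theta>a\<^sup>2) N (X' (\<eta> s)) (\<eta> s)) / \<epsilon>)"
      by (rule mult_left_mono) simp
    also have "\<dots> = - \<Phi>' s"
      unfolding \<Phi>'_def energy_minus_right energy_commute[of P _ _ "u s"] energy_commute[of P' _ _ "\<eta> s"]
        abs_minus_commute[of a b] by (simp add: algebra_simps)
    finally show ?thesis by (simp add: g'_def abs_mult)
  qed
  have "g t + \<Phi> t \<le> g 0 + \<Phi> 0"
  proof (rule DERIV_nonpos_imp_nonincreasing[OF t])
    fix s
    show "\<exists>y. ((\<lambda>s. g s + \<Phi> s) has_real_derivative y) (at s) \<and> y \<le> 0"
      using DERIV_add[OF dg d\<Phi>, of s] bd[of s] by (intro exI[of _ "g' s + \<Phi>' s"]) auto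
  qed
  moreover have "- g t + \<Phi> t \<le> - g 0 + \<Phi> 0"
  proof (rule DERIV_nonpos_imp_nonincreasing[OF t])
    fix s
    show "\<exists>y. ((\<lambda>s. - g s + \<Phi> s) has_real_derivative y) (at s) \<and> y \<le> 0"
      using DERIV_add[OF DERIV_minus[OF dg] d\<Phi>, of s] bd[of s] by (intro exI[of _ "- g' s + \<Phi>' s"]) auto
  qed
  ultimately have "\<bar>g 0 - g t\<bar> \<le> \<Phi> 0 - \<Phi> t" by linarith
  also have "\<dots> \<le> \<bar>a - b\<bar> * (\<epsilon> * v + K\<^sup>2 * (norm y)\<^sup>2 / (a * \<epsilon>))"
  proof -
    let ?E = "\<lambda>s. h * \<theta>b * energy P (\<theta>b\<^sup>2) M (u s) (u s)"
    let ?F = "\<lambda>s. h * \<theta>a * energy P' (\<theta>a\<^sup>2) N (\<eta> s) (\<eta> s)"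
    \<comment> \<open>Because of the opposite signs in \<open>\<Phi>\<close>, only
      \<open>?E 0\<close> and \<open>?F t\<close> need upper bounds; the other two end values are
      dropped by their sign.\<close>
    have "0 \<le> ?E t" "0 \<le> ?F 0"
      using pos da db by (auto intro!: mult_nonneg_nonneg energy_nonneg)
    moreover have "?E 0 \<le> v" using v[of M] by (simp add: u_def blinfun_exp_zero \<theta>b_def)
    moreover have "?F t \<le> K\<^sup>2 * (norm y)\<^sup>2 / a"
    proof -
      have "?F t \<le> h * \<theta>a * (K\<^sup>2 * (norm y)\<^sup>2 / (1 - \<theta>a\<^sup>2))"
        using energy_le_norm[OF pow', of "\<theta>a\<^sup>2" N y] sq pos da
        by (intro mult_left_mono) (auto simp: \<eta>_def blinfun_exp_zero)
      also have "\<dots> = h * \<theta>a / (1 - \<theta>a\<^sup>2) * (K\<^sup>2 * (norm y)\<^sup>2)" by simp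
      also have "\<dots> \<le> 1 / a * (K\<^sup>2 * (norm y)\<^sup>2)" by (intro mult_right_mono da) auto
      finally show ?thesis by simp
    qed
    ultimately have "\<epsilon> * ?E 0 - ?F 0 / \<epsilon> - (\<epsilon> * ?E t - ?F t / \<epsilon>) \<le> \<epsilon> * v + (K\<^sup>2 * (norm y)\<^sup>2 / a) / \<epsilon>"
      using pos by (smt (verit) divide_right_mono divide_nonneg_nonneg mult_left_mono mult_nonneg_nonneg)
    from mult_left_mono[OF this, of "\<bar>a - b\<bar>"] show ?thesis
      by (simp add: \<Phi>_def right_diff_distrib)
  qed
  \<comment> \<open>At \<open>s = 0\<close> the pairing is the flow of \<open>X\<close> tested
    against \<open>y\<close>, moved to the adjoint; at \<open>s = t\<close> it is the flow of
    \<open>Y\<close>.\<close>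
  finally show ?thesis
    by (simp add: g_def u_def \<eta>_def blinfun_exp_zero exp_adjoint[OF X', of "- t", simplified] inner_diff_left)
qed

text \<open>
  The energy with weights \<open>\<theta> ^ n\<close>, instead of \<open>\<theta> ^ (2 * n)\<close>, still decreases along the flow, and the
  remaining factor \<open>\<theta> ^ n\<close> makes the Neumann series of \<open>X\<close> controllable by Cauchy--Schwarz.
\<close>

lemma resolvent_flow_bound:
  fixes P X :: "'a::{real_inner, complete_space} \<Rightarrow>\<^sub>L 'a"
  assumes pow: "\<And>n z. norm (blinfun_pow P n z) \<le> K * norm z" and K: "1 \<le> K"
    and res: "quot_resolvent h P a X"
    and pos: "a > 0" "h > 0" and t: "0 \<le> t"
  shows "norm (X (blinfun_exp ((- t) *\<^sub>R X) z)) \<le> 2 * K / a * norm z"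
proof -
  define \<theta> where "\<theta> = 1 / (1 + a * h)"
  note d = discount_bounds[OF pos, folded \<theta>_def]
  define c where "c = h * \<theta>"
  have c: "c > 0" "c / (1 - \<theta>) = 1 / a" using d pos by (auto simp: c_def)
  obtain N where N: "\<theta> ^ N * K\<^sup>2 \<le> 1 / 2" using discount_power_small d by (metis less_imp_le)
  have th: "((sqrt \<theta>)\<^sup>2) = \<theta>" "sqrt \<theta> * sqrt \<theta> = \<theta>" using d by auto
  define u where "u s = blinfun_exp ((- s) *\<^sub>R X) z" for s
  have du: "(u has_vector_derivative - X (u s)) (at s)" for s
    unfolding u_def by (rule exp_flow_derivative)
  have "energy P \<theta> N (u t) (u t) \<le> energy P \<theta> N (u 0) (u 0)"
  proof (rule DERIV_nonpos_imp_nonincreasing[OF t])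
    fix s
    have "0 \<le> sqrt \<theta> / 2 * (norm (X (u s)))\<^sup>2" using d by simp
    \<comment> \<open>Taking \<open>sqrt \<theta>\<close> for both \<open>r\<close> and
      \<open>\<sigma>\<close> produces the weights \<open>\<theta> ^ n\<close>.\<close>
    also have "\<dots> \<le> 2 * c * energy P \<theta> N (X (u s)) (u s)"
      using quot_resolvent_coercive[OF pow res pos, where r = "sqrt \<theta>" and \<sigma> = "sqrt \<theta>" and N = N and w = "u s"] N d
      by (simp add: th c_def \<theta>_def[symmetric])
    finally have "0 \<le> energy P \<theta> N (u s) (X (u s))"
      using c by (simp add: zero_le_mult_iff energy_commute)
    then show "\<exists>y. ((\<lambda>s. energy P \<theta> N (u s) (u s)) has_real_derivative y) (at s) \<and> y \<le> 0"
      by (intro exI[of _ "2 * energy P \<theta> N (u s) (- X (u s))"] conjI energy_has_derivative du)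
         (simp add: energy_minus_right)
  qed
  also have "\<dots> \<le> K\<^sup>2 * (norm z)\<^sup>2 / (1 - \<theta>)"
    using energy_le_norm[OF pow, of \<theta> N z] d by (simp add: u_def blinfun_exp_zero)
  finally have E: "energy P \<theta> N (u t) (u t) \<le> K\<^sup>2 * (norm z)\<^sup>2 / (1 - \<theta>)" .
  define w v where "w = u t" and "v = X w"
  have step: "v = c *\<^sub>R w + \<theta> *\<^sub>R P v"
  proof -
    have e: "\<theta> * (1 + a * h) = 1" using pos by (simp add: \<theta>_def) (smt (verit) mult_pos_pos)
    have "(1 + a * h) *\<^sub>R v - P v = h *\<^sub>R w" using res by (simp add: quot_resolvent_def v_def)
    then have "\<theta> *\<^sub>R ((1 + a * h) *\<^sub>R v - P v) = \<theta> *\<^sub>R (h *\<^sub>R w)" by simp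
    then have "v - \<theta> *\<^sub>R P v = (h * \<theta>) *\<^sub>R w"
      by (simp only: scaleR_diff_right scaleR_scaleR e scaleR_one mult.commute)
    then show ?thesis by (simp add: c_def diff_eq_eq)
  qed
  \<comment> \<open>The Neumann series of \<open>X\<close>, cut off after \<open>m\<close> terms
    with its exact remainder.\<close>
  have expand: "v = c *\<^sub>R (\<Sum>n<m. \<theta> ^ n *\<^sub>R blinfun_pow P n w) + \<theta> ^ m *\<^sub>R blinfun_pow P m v" for m
  proof (induction m)
    case (Suc m)
    have eq: "blinfun_pow P m v = c *\<^sub>R blinfun_pow P m w + \<theta> *\<^sub>R blinfun_pow P (Suc m) v"
      by (subst step) (simp add: blinfun.add_right blinfun.scaleR_right blinfun_pow_Suc_right[symmetric] del: blinfun_pow.simps)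
    show ?case
      using arg_cong[OF eq, of "scaleR (\<theta> ^ m)"] Suc.IH
      by (simp add: scaleR_add_right add.assoc mult.commute)
  qed simp
  have "norm (\<Sum>n<N. \<theta> ^ n *\<^sub>R blinfun_pow P n w) \<le> (\<Sum>n<N. \<theta> ^ n * norm (blinfun_pow P n w))"
    using d by (intro sum_norm_le) simp
  also have "\<dots> \<le> K * norm z / (1 - \<theta>)"
  \<comment> \<open>Each weight is split into two square roots. Cauchy-Schwarz then leaves a
    geometric sum and the energy, each contributing a factor
    \<open>1 / (1 - \<theta>)\<close>.\<close>
  proof (rule power2_le_imp_le)
    have "(\<Sum>n<N. \<theta> ^ n * norm (blinfun_pow P n w))\<^sup>2
        = (\<Sum>n<N. sqrt (\<theta> ^ n) * (sqrt (\<theta> ^ n) * norm (blinfun_pow P n w)))\<^sup>2"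
      using d by (simp add: mult.assoc[symmetric])
    also have "\<dots> \<le> (\<Sum>n<N. (sqrt (\<theta> ^ n))\<^sup>2) * (\<Sum>n<N. (sqrt (\<theta> ^ n) * norm (blinfun_pow P n w))\<^sup>2)"
      by (rule Cauchy_Schwarz_ineq_sum)
    also have "\<dots> = (\<Sum>n<N. \<theta> ^ n) * energy P \<theta> N w w"
      using d by (simp add: energy_def power_mult_distrib power2_norm_eq_inner)
    also have "\<dots> \<le> 1 / (1 - \<theta>) * (K\<^sup>2 * (norm z)\<^sup>2 / (1 - \<theta>))"
    proof (intro mult_mono)
      show "(\<Sum>n<N. \<theta> ^ n) \<le> 1 / (1 - \<theta>)"
        using d by (simp add: sum_gp_strict divide_right_mono)
    qed (use E d in \<open>auto simp: w_def intro!: energy_nonneg\<close>)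
    finally show "(\<Sum>n<N. \<theta> ^ n * norm (blinfun_pow P n w))\<^sup>2 \<le> (K * norm z / (1 - \<theta>))\<^sup>2"
      by (simp add: power2_eq_square mult_ac)
  qed (use K d in auto)
  finally have S: "norm (\<Sum>n<N. \<theta> ^ n *\<^sub>R blinfun_pow P n w) \<le> K * norm z / (1 - \<theta>)" .
  \<comment> \<open>The remainder is at most half of \<open>norm v\<close> and is absorbed on the
    left at the end, which doubles the constant. The passage from \<open>K\<close> to
    \<open>K\<^sup>2\<close> matches the choice of \<open>N\<close>.\<close>
  have "norm (\<theta> ^ N *\<^sub>R blinfun_pow P N v) \<le> \<theta> ^ N * (K\<^sup>2 * norm v)"
  proof -
    have "K * norm v \<le> K\<^sup>2 * norm v" using K by (intro mult_right_mono) (auto simp: power2_eq_square)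
    with pow[of N v] d show ?thesis by (simp add: mult_left_mono)
  qed
  also have "\<dots> \<le> 1 / 2 * norm v" using mult_right_mono[OF N, of "norm v"] by simp
  finally have T: "norm (\<theta> ^ N *\<^sub>R blinfun_pow P N v) \<le> 1 / 2 * norm v" .
  have "norm v \<le> c * norm (\<Sum>n<N. \<theta> ^ n *\<^sub>R blinfun_pow P n w) + norm (\<theta> ^ N *\<^sub>R blinfun_pow P N v)"
    using c by (subst expand[of N]) (rule order_trans[OF norm_triangle_ineq], simp)
  also have "\<dots> \<le> c * (K * norm z / (1 - \<theta>)) + 1 / 2 * norm v"
    using S T c by (intro add_mono mult_left_mono) auto
  also have "c * (K * norm z / (1 - \<theta>)) = c / (1 - \<theta>) * (K * norm z)" by simp
  finally show ?thesis unfolding c by (simp add: v_def w_def u_def)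
qed

section \<open>Neumann series and resolvents of the difference quotients\<close>

text \<open>Summability of the powers is assumed instead of \<open>norm D < 1\<close>, since a
  discounted power-bounded operator satisfies the former but may have norm above 1.\<close>

lemma neumann_inverse:
  fixes D :: "'a::{real_normed_vector, complete_space} \<Rightarrow>\<^sub>L 'a"
  assumes D: "summable (\<lambda>n. norm (blinfun_pow D n))"
  shows "\<exists>S :: 'a \<Rightarrow>\<^sub>L 'a. norm S \<le> (\<Sum>n. norm (blinfun_pow D n)) \<and>
    (\<forall>x. blinfun_apply S (x - D x) = x) \<and> (\<forall>x. blinfun_apply S x - D (S x) = x)"
proof -
  define S where "S = (\<Sum>n. blinfun_pow D n)"
  note sD = summable_norm_blinfun[OF D]
  have S: "(\<lambda>n. blinfun_pow D n x) sums S x" for x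
    unfolding S_def by (rule blinfun_apply_suminf[OF sD])
  have "(\<lambda>n. blinfun_pow D (Suc n) x) sums D (S x)" for x
    using bounded_linear.sums[OF blinfun.bounded_linear_right S] by simp
  from sums_Suc[OF this] have "(\<lambda>n. blinfun_pow D n x) sums (D (S x) + x)" for x by simp
  from sums_unique2[OF S this] have 1: "S x = D (S x) + x" for x .
  have "(\<lambda>n. blinfun_pow D (Suc n) x) sums S (D x)" for x
    unfolding blinfun_pow_Suc_right by (rule S)
  from sums_Suc[OF this] have "(\<lambda>n. blinfun_pow D n x) sums (S (D x) + x)" for x by simp
  from sums_unique2[OF S this] have 2: "S x = S (D x) + x" for x .
  have "norm S \<le> (\<Sum>n. norm (blinfun_pow D n))"
  proof (rule LIMSEQ_le)
    show "(\<lambda>m. norm (\<Sum>n<m. blinfun_pow D n)) \<longlonglongrightarrow> norm S"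
      unfolding S_def by (intro tendsto_norm summable_LIMSEQ sD)
    show "(\<lambda>m. \<Sum>n<m. norm (blinfun_pow D n)) \<longlonglongrightarrow> (\<Sum>n. norm (blinfun_pow D n))"
      by (rule summable_LIMSEQ[OF D])
  qed (auto intro!: exI[of _ 0] norm_sum)
  moreover have "S (x - D x) = x" "S x - D (S x) = x" for x
    using 1[of x] 2[of x] by (simp_all only: blinfun.diff_right diff_eq_eq add.commute)
  ultimately show ?thesis by blast
qed

text \<open>Dividing by \<open>1 + a * h\<close> reduces the equation to inverting
  \<open>id - \<theta> P\<close>, whose Neumann series has norm at most
  \<open>K / (1 - \<theta>)\<close>; the factor \<open>h * \<theta>\<close> turns this into
  \<open>K / a\<close>.\<close>

lemma quot_resolvent_exists:
  fixes P :: "'a::{real_normed_vector, complete_space} \<Rightarrow>\<^sub>L 'a"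
  assumes pow: "\<And>n z. norm (blinfun_pow P n z) \<le> K * norm z" and K: "0 \<le> K"
    and pos: "a > 0" "h > 0"
  shows "\<exists>X. quot_resolvent h P a X \<and> norm X \<le> K / a"
proof -
  define \<theta> where "\<theta> = 1 / (1 + a * h)"
  note d = discount_bounds[OF pos, folded \<theta>_def]
  have e: "\<theta> * (1 + a * h) = 1" using pos by (simp add: \<theta>_def) (smt (verit) mult_pos_pos)
  have nb: "norm (blinfun_pow (\<theta> *\<^sub>R P) n) \<le> \<theta> ^ n * K" for n
    using d norm_blinfun_bound[OF K pow, of n] by (simp add: blinfun_pow_scaleR mult_left_mono)
  have sg: "(\<lambda>n. \<theta> ^ n * K) sums (1 / (1 - \<theta>) * K)"
    using d by (intro sums_mult2 geometric_sums) auto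
  have sD: "summable (\<lambda>n. norm (blinfun_pow (\<theta> *\<^sub>R P) n))"
    by (rule summable_comparison_test'[OF sums_summable[OF sg]]) (use nb in auto)
  obtain S :: "'a \<Rightarrow>\<^sub>L 'a" where S: "\<And>x. blinfun_apply S (x - (\<theta> *\<^sub>R P) x) = x" "\<And>x. blinfun_apply S x - (\<theta> *\<^sub>R P) (S x) = x"
    "norm S \<le> (\<Sum>n. norm (blinfun_pow (\<theta> *\<^sub>R P) n))"
    using neumann_inverse[OF sD] by blast
  have "(\<Sum>n. norm (blinfun_pow (\<theta> *\<^sub>R P) n)) \<le> 1 / (1 - \<theta>) * K"
    using suminf_le[OF nb sD sums_summable[OF sg]] sums_unique[OF sg] by simp
  then have nS: "norm S \<le> 1 / (1 - \<theta>) * K" using S(3) by linarith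
  have eq: "(1 + a * h) *\<^sub>R w - P w = (1 + a * h) *\<^sub>R (w - (\<theta> *\<^sub>R P) w)" for w
    using e by (simp add: blinfun.scaleR_left scaleR_diff_right mult.commute)
  have "quot_resolvent h P a ((h * \<theta>) *\<^sub>R S)"
    unfolding quot_resolvent_def
  proof (intro conjI allI)
    fix w
    have "(1 + a * h) *\<^sub>R ((h * \<theta>) *\<^sub>R S) w - P (((h * \<theta>) *\<^sub>R S) w)
        = (h * \<theta>) *\<^sub>R ((1 + a * h) *\<^sub>R S w - P (S w))"
      by (simp add: blinfun.scaleR_left blinfun.scaleR_right scaleR_diff_right mult.commute)
    also have "\<dots> = (h * (\<theta> * (1 + a * h))) *\<^sub>R (S w - (\<theta> *\<^sub>R P) (S w))"
      unfolding eq scaleR_scaleR mult.assoc ..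
    finally show "(1 + a * h) *\<^sub>R ((h * \<theta>) *\<^sub>R S) w - P (((h * \<theta>) *\<^sub>R S) w) = h *\<^sub>R w"
      by (simp only: e S mult_1_right)
    have "((h * \<theta>) *\<^sub>R S) ((1 + a * h) *\<^sub>R w - P w) = (h * (\<theta> * (1 + a * h))) *\<^sub>R S (w - (\<theta> *\<^sub>R P) w)"
      unfolding eq blinfun.scaleR_left blinfun.scaleR_right scaleR_scaleR by (simp add: mult_ac)
    then show "((h * \<theta>) *\<^sub>R S) ((1 + a * h) *\<^sub>R w - P w) = h *\<^sub>R w"
      by (simp only: e S mult_1_right)
  qed
  moreover have "norm ((h * \<theta>) *\<^sub>R S) \<le> K / a"
  proof -
    have "norm ((h * \<theta>) *\<^sub>R S) \<le> h * \<theta> * (1 / (1 - \<theta>) * K)"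
      using mult_left_mono[OF nS, of "h * \<theta>"] pos d by simp
    also have "\<dots> = h * \<theta> / (1 - \<theta>) * K" by simp
    finally show ?thesis by (simp add: d)
  qed
  ultimately show ?thesis by blast
qed

lemma quot_resolvent_commute:
  fixes P X Y :: "'a::real_normed_vector \<Rightarrow>\<^sub>L 'a"
  assumes X: "quot_resolvent h P a X" and Y: "\<And>w. Y (P w) = P (Y w)" and h: "h > 0"
  shows "Y (X w) = X (Y w)"
proof -
  have "h *\<^sub>R Y (X w) = X ((1 + a * h) *\<^sub>R Y (X w) - P (Y (X w)))"
    using X by (simp add: quot_resolvent_def)
  also have "(1 + a * h) *\<^sub>R Y (X w) - P (Y (X w)) = Y ((1 + a * h) *\<^sub>R X w - P (X w))"
    by (simp only: Y blinfun.diff_right blinfun.scaleR_right)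
  also have "\<dots> = h *\<^sub>R Y w" using X by (simp add: quot_resolvent_def blinfun.scaleR_right)
  finally show ?thesis using h by (simp add: blinfun.scaleR_right)
qed

subsection \<open>Resolvents of the generator\<close>

locale bounded_c0_semigroup =
  fixes T :: "real \<Rightarrow> ('a::{real_inner, complete_space} \<Rightarrow>\<^sub>L 'a)" and R :: "'a \<Rightarrow>\<^sub>L 'a" and K :: real
  assumes c0: "c0_semigroup T"
    and res1: "bounded_inverse_of (gen_dom T) (\<lambda>x. x - gen T x) R"
    and K: "1 \<le> K" and bound: "\<And>t. 0 \<le> t \<Longrightarrow> norm (T t) \<le> K"
begin

lemma T_0: "T 0 x = x"
  using c0 by (simp add: c0_semigroup_def)

lemma T_add: "0 \<le> s \<Longrightarrow> 0 \<le> t \<Longrightarrow> T (s + t) x = T s (T t x)"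
  using c0 by (simp add: c0_semigroup_def)

lemma T_commute: "0 \<le> s \<Longrightarrow> 0 \<le> t \<Longrightarrow> T s (T t x) = T t (T s x)"
  by (metis T_add add.commute)

lemma T_pow: "0 \<le> h \<Longrightarrow> blinfun_pow (T h) n x = T (real n * h) x"
proof (induction n)
  case (Suc n)
  then have "T (h + real n * h) x = T h (T (real n * h) x)" by (intro T_add) auto
  with Suc show ?case by (simp add: algebra_simps)
qed (simp add: T_0)

lemma T_bound: "0 \<le> t \<Longrightarrow> norm (T t x) \<le> K * norm x"
  by (meson bound mult_right_mono norm_blinfun norm_ge_zero order_trans)

lemma T_pow_bound: "0 \<le> h \<Longrightarrow> norm (blinfun_pow (T h) n x) \<le> K * norm x"
  by (simp add: T_pow T_bound)

lemma gen_tendsto: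
  assumes "x \<in> gen_dom T"
  shows "((\<lambda>h. (1 / h) *\<^sub>R (T h x - x)) \<longlongrightarrow> gen T x) (at_right 0)"
proof -
  obtain y where y: "((\<lambda>h. (1 / h) *\<^sub>R (T h x - x)) \<longlongrightarrow> y) (at_right 0)"
    using assms by (auto simp: gen_dom_def)
  then have "gen T x = y" unfolding gen_def by (intro tendsto_Lim) simp_all
  with y show ?thesis by simp
qed

lemma gen_eqI:
  assumes "((\<lambda>h. (1 / h) *\<^sub>R (T h x - x)) \<longlongrightarrow> y) (at_right 0)"
  shows "x \<in> gen_dom T" "gen T x = y"
  using assms tendsto_Lim[OF _ assms] by (auto simp: gen_dom_def gen_def)

definition resolvent_at :: "real \<Rightarrow> ('a \<Rightarrow>\<^sub>L 'a) \<Rightarrow> bool" where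
  "resolvent_at a X \<longleftrightarrow> bounded_inverse_of (gen_dom T) (\<lambda>x. a *\<^sub>R x - gen T x) X"

lemma resolvent_atD:
  assumes "resolvent_at a X"
  shows "X x \<in> gen_dom T" "gen T (X x) = a *\<^sub>R X x - x"
    "y \<in> gen_dom T \<Longrightarrow> X (a *\<^sub>R y - gen T y) = y"
proof -
  show "X x \<in> gen_dom T" using assms by (simp add: resolvent_at_def bounded_inverse_of_def)
  have "a *\<^sub>R X x - gen T (X x) = x" using assms by (simp add: resolvent_at_def bounded_inverse_of_def)
  then show "gen T (X x) = a *\<^sub>R X x - x" by (simp add: algebra_simps)
  show "y \<in> gen_dom T \<Longrightarrow> X (a *\<^sub>R y - gen T y) = y"
    using assms by (simp add: resolvent_at_def bounded_inverse_of_def)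
qed

lemma resolvent_at_1: "resolvent_at 1 R"
  using res1 by (simp add: resolvent_at_def)

lemmas R_dom = resolvent_atD(1)[OF resolvent_at_1]
lemmas gen_R = resolvent_atD(2)[OF resolvent_at_1, simplified]

text \<open>Applying \<open>T t\<close> to the difference quotients at \<open>X x\<close> shows that
  \<open>T t (X x)\<close> lies in the domain and identifies its image under the generator; the left
  inverse property then concludes.\<close>

lemma resolvent_commute_T:
  assumes X: "resolvent_at a X" and t: "0 \<le> t"
  shows "X (T t x) = T t (X x)"
proof -
  note D = resolvent_atD[OF X]
  have "((\<lambda>h. T t ((1 / h) *\<^sub>R (T h (X x) - X x))) \<longlongrightarrow> T t (a *\<^sub>R X x - x)) (at_right 0)"
    using gen_tendsto[OF D(1)] unfolding D(2) by (intro tendsto_intros)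
  moreover have "eventually (\<lambda>h. T t ((1 / h) *\<^sub>R (T h (X x) - X x)) = (1 / h) *\<^sub>R (T h (T t (X x)) - T t (X x))) (at_right 0)"
    using eventually_at_right_less[of 0]
    by eventually_elim (simp add: blinfun.bilinear_simps T_commute[OF t] less_imp_le)
  ultimately have "((\<lambda>h. (1 / h) *\<^sub>R (T h (T t (X x)) - T t (X x))) \<longlongrightarrow> T t (a *\<^sub>R X x - x)) (at_right 0)"
    by (rule Lim_transform_eventually)
  note G = gen_eqI[OF this]
  from D(3)[OF G(1)] show ?thesis unfolding G(2) by (simp add: blinfun.bilinear_simps)
qed

lemma resolvent_identity:
  assumes X: "resolvent_at a X" and Y: "resolvent_at b Y"
  shows "X z - Y z = (b - a) *\<^sub>R X (Y z)"
proof -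
  have "Y z = X (a *\<^sub>R Y z - (b *\<^sub>R Y z - z))"
    using resolvent_atD(3)[OF X resolvent_atD(1)[OF Y, of z]] by (simp add: resolvent_atD(2)[OF Y])
  then show ?thesis by (simp add: blinfun.bilinear_simps algebra_simps)
qed

lemma resolvents_commute:
  assumes X: "resolvent_at a X" and Y: "resolvent_at b Y" and "a \<noteq> b"
  shows "X (Y z) = Y (X z)"
proof -
  have "X z - Y z = (b - a) *\<^sub>R Y (X z)"
    using resolvent_identity[OF Y X, of z] by (metis minus_diff_eq scaleR_minus_left)
  then have "(b - a) *\<^sub>R X (Y z) = (b - a) *\<^sub>R Y (X z)"
    by (simp add: resolvent_identity[OF X Y])
  then show ?thesis using \<open>a \<noteq> b\<close> by simp
qed

text \<open>Telescoping over \<open>n\<close> steps of length \<open>h / n\<close> needs only the right derivative at \<open>0\<close>.\<close>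

lemma taylor_bound:
  assumes v: "v \<in> gen_dom T" and h: "h > 0"
    and S: "\<And>r. 0 \<le> r \<Longrightarrow> r \<le> h \<Longrightarrow> norm (T r (gen T v) - gen T v) \<le> S"
  shows "norm (T h v - v - h *\<^sub>R gen T v) \<le> h * S"
proof -
  let ?a = "gen T v"
  define q where "q r = (1 / r) *\<^sub>R (T r v - v) - ?a" for r
  have main: "norm (T h v - v - h *\<^sub>R ?a) \<le> K * h * norm (q (h / Suc m)) + h * S" for m
  proof -
    define n where "n = Suc m"
    define r where "r = h / n"
    have r: "r > 0" "real n * r = h" using h by (auto simp: r_def n_def)
    have "T h v - v = (\<Sum>k<n. T (real (Suc k) * r) v - T (real k * r) v)"
      using sum_lessThan_telescope[of "\<lambda>k. T (real k * r) v" n] r by (simp add: T_0)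
    \<comment> \<open>Each increment is \<open>T (k * r)\<close> applied to \<open>r\<close> times
      \<open>q r + ?a\<close>. The defect \<open>q r\<close> is kept apart, and moving
      \<open>T (k * r) ?a\<close> back to \<open>?a\<close> costs at most \<open>S\<close>.\<close>
    also have "\<dots> = (\<Sum>k<n. r *\<^sub>R T (real k * r) (q r) + r *\<^sub>R (T (real k * r) ?a - ?a) + r *\<^sub>R ?a)"
    proof (rule sum.cong)
      fix k
      have "T (real k * r + r) v = T (real k * r) (T r v)" using r by (intro T_add) auto
      moreover have "T r v = v + r *\<^sub>R q r + r *\<^sub>R ?a" using r by (simp add: q_def algebra_simps)
      ultimately show "T (real (Suc k) * r) v - T (real k * r) v
          = r *\<^sub>R T (real k * r) (q r) + r *\<^sub>R (T (real k * r) ?a - ?a) + r *\<^sub>R ?a"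
        by (simp add: blinfun.bilinear_simps algebra_simps)
    qed simp
    also have "\<dots> = (\<Sum>k<n. r *\<^sub>R T (real k * r) (q r) + r *\<^sub>R (T (real k * r) ?a - ?a)) + h *\<^sub>R ?a"
      using r by (simp add: sum.distrib sum_constant_scaleR)
    finally have "norm (T h v - v - h *\<^sub>R ?a)
        \<le> (\<Sum>k<n. norm (r *\<^sub>R T (real k * r) (q r) + r *\<^sub>R (T (real k * r) ?a - ?a)))"
      by (simp add: norm_sum)
    also have "\<dots> \<le> (\<Sum>k<n. r * (K * norm (q r)) + r * S)"
    proof (rule sum_mono)
      fix k assume "k \<in> {..<n}"
      then have "real k * r \<le> real n * r" using r by (intro mult_right_mono) auto
      then have k: "0 \<le> real k * r" "real k * r \<le> h" using r by auto
      show "norm (r *\<^sub>R T (real k * r) (q r) + r *\<^sub>R (T (real k * r) ?a - ?a)) \<le> r * (K * norm (q r)) + r * S"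
        using r T_bound[OF k(1), of "q r"] S[OF k]
        by (intro order_trans[OF norm_triangle_ineq] add_mono) (auto intro!: mult_left_mono)
    qed
    also have "\<dots> = (real n * r) * (K * norm (q r)) + (real n * r) * S" by (simp add: distrib_left)
    finally show ?thesis unfolding r by (simp add: r_def n_def mult_ac)
  qed
  \<comment> \<open>Refining the subdivision removes the contribution of \<open>q\<close>.\<close>
  have "(q \<longlongrightarrow> gen T v - gen T v) (at_right 0)"
    unfolding q_def by (intro tendsto_diff gen_tendsto v tendsto_const)
  moreover have "filterlim (\<lambda>m. h / real (Suc m)) (at_right 0) sequentially"
    using LIMSEQ_Suc[OF lim_const_over_n[of h]] h by (intro filterlim_at_withinI) auto
  ultimately have "(\<lambda>m. q (h / Suc m)) \<longlonglongrightarrow> 0"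
    using filterlim_compose by fastforce
  then have "(\<lambda>m. K * h * norm (q (h / Suc m)) + h * S) \<longlonglongrightarrow> K * h * norm (0::'a) + h * S"
    by (intro tendsto_intros)
  from LIMSEQ_le_const[OF this] main show ?thesis by simp
qed

text \<open>The Taylor bound with the crude oscillation estimate \<open>K + 1\<close>; the constant
  obtained is uniform over bounded sets of \<open>x\<close>.\<close>

lemma T_R_lipschitz:
  assumes h: "h > 0"
  shows "norm (T h (R x) - R x) \<le> h * ((K + 2) * norm (R x - x))"
proof -
  let ?a = "R x - x"
  have "norm (T h (R x) - R x - h *\<^sub>R gen T (R x)) \<le> h * ((K + 1) * norm ?a)"
  proof (rule taylor_bound[OF R_dom h])
    fix r :: real assume "0 \<le> r"
    have "norm (T r ?a - ?a) \<le> norm (T r ?a) + norm ?a" by (rule norm_triangle_ineq4)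
    with T_bound[OF \<open>0 \<le> r\<close>, of ?a] show "norm (T r (gen T (R x)) - gen T (R x)) \<le> (K + 1) * norm ?a"
      by (simp add: gen_R algebra_simps)
  qed
  moreover have "norm (T h (R x) - R x) \<le> norm (T h (R x) - R x - h *\<^sub>R ?a) + norm (h *\<^sub>R ?a)"
    by (metis diff_add_cancel norm_triangle_ineq)
  moreover have "norm (h *\<^sub>R ?a) = h * norm ?a" using h by simp
  moreover have "h * ((K + 2) * norm ?a) = h * ((K + 1) * norm ?a) + h * norm ?a"
    by (simp add: distrib_left distrib_right)
  ultimately show ?thesis unfolding gen_R by linarith
qed

text \<open>The generator maps \<open>R (R x)\<close> to \<open>R (R x - x)\<close>, which is again
  in the range of \<open>R\<close> and so has a Lipschitz orbit. The Taylor error is therefore of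
  order \<open>h\<^sup>2\<close>, and the quotient converges at rate \<open>h\<close> in operator
  norm.\<close>

lemma quotient_R_square:
  assumes h: "h > 0"
  shows "norm ((1 / h) *\<^sub>R (T h (R (R x)) - R (R x)) - (R (R x) - R x)) \<le> h * ((K + 2) * (norm R + 1)\<^sup>2) * norm x"
proof -
  define B where "B = (K + 2) * (norm R + 1)\<^sup>2 * norm x"
  have step: "norm (R y - y) \<le> (norm R + 1) * norm y" for y
    using norm_triangle_ineq4[of "R y" y] norm_blinfun[of R y] by (simp add: algebra_simps)
  have "norm (R (R x - x) - (R x - x)) \<le> (norm R + 1) * ((norm R + 1) * norm x)"
    by (rule order_trans[OF step mult_left_mono[OF step]]) simp
  then have B: "(K + 2) * norm (R (R x - x) - (R x - x)) \<le> B"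
    unfolding B_def power2_eq_square mult.assoc using K by (intro mult_left_mono) auto
  have "norm (T h (R (R x)) - R (R x) - h *\<^sub>R gen T (R (R x))) \<le> h * (h * B)"
  proof (rule taylor_bound[OF R_dom h])
    fix r :: real assume r: "0 \<le> r" "r \<le> h"
    show "norm (T r (gen T (R (R x))) - gen T (R (R x))) \<le> h * B"
    proof (cases "r = 0")
      case True
      have "0 \<le> B" using B K by (smt (verit) mult_nonneg_nonneg norm_ge_zero)
      with True h show ?thesis by (simp add: T_0)
    next
      case False
      then have "norm (T r (R (R x - x)) - R (R x - x)) \<le> r * ((K + 2) * norm (R (R x - x) - (R x - x)))"
        using r by (intro T_R_lipschitz) auto
      also have "\<dots> \<le> h * B" using B r K by (intro mult_mono) auto
      finally show ?thesis by (simp add: gen_R blinfun.diff_right)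
    qed
  qed
  moreover have "(1 / h) *\<^sub>R (T h (R (R x)) - R (R x)) - (R (R x) - R x)
      = (1 / h) *\<^sub>R (T h (R (R x)) - R (R x) - h *\<^sub>R gen T (R (R x)))"
    using h by (simp add: gen_R scaleR_diff_right)
  moreover have "norm ((1 / h) *\<^sub>R u) = norm u / h" for u :: 'a using h by simp
  moreover have "h * ((K + 2) * (norm R + 1)\<^sup>2) * norm x = h * B" by (simp add: B_def mult_ac)
  ultimately show ?thesis using h by (simp only: pos_divide_le_eq mult.commute)
qed

text \<open>
  With \<open>N = I - (1 - a) R\<close> one has \<open>(a - A) R = N\<close>, so \<open>N\<close> has to be inverted. Now
  \<open>I = N (2 I - N) + (1 - a)\<^sup>2 R\<^sup>2\<close>, and telescoping \<open>R\<^sup>2\<close> along the discounted orbit shows that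
  \<open>R\<^sup>2\<close> is \<open>N\<close> times a bounded operator up to a small error. The square of \<open>R\<close> is needed for the
  difference quotients to converge in operator norm.
\<close>

lemma resolvent_exists:
  assumes a: "0 \<le> a" "a \<le> 1" and decay: "\<And>e. e > 0 \<Longrightarrow> \<exists>s>0. norm (T s o\<^sub>L R) \<le> e"
  shows "\<exists>X. resolvent_at a X"
proof -
  define C where "C = (K + 2) * (norm R + 1)\<^sup>2"
  have C: "C \<ge> 0" using K by (simp add: C_def)
  \<comment> \<open>For \<open>a = 0\<close> there is no discounting, so the end term of the
    telescoped sum must be small by decay. This error and the discretisation error each receive a
    quarter, which makes \<open>norm D\<close> at most one half.\<close>
  obtain s where s: "s > 0" "norm (T s o\<^sub>L R) \<le> 1 / (4 * (norm R + 1))"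
    using decay[of "1 / (4 * (norm R + 1))"] by (auto simp: add_nonneg_pos)
  obtain n :: nat where n: "4 * (s * K * C * s) < real n" using reals_Archimedean2 by blast
  then have n0: "real n > 0" using s K C by (smt (verit) mult_nonneg_nonneg)
  define h where "h = s / n"
  have h: "h > 0" "real n * h = s" using s n0 by (auto simp: h_def)
  have small: "s * K * C * h \<le> 1 / 4" using n n0 by (simp add: h_def field_simps)
  define \<theta> where "\<theta> = 1 / (1 + a * h)"
  have ah: "1 + a * h \<ge> 1" using a h by simp
  have \<theta>: "0 < \<theta>" "\<theta> \<le> 1" "\<theta> * (1 + a * h) = 1" using ah by (auto simp: \<theta>_def)
  define N where "N = id_blinfun - (1 - a) *\<^sub>R R"
  have N: "N x = x - (1 - a) *\<^sub>R R x" for x by (simp add: N_def blinfun.bilinear_simps)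
  define W where "W = (\<Sum>k<n. \<theta> ^ k *\<^sub>R T (real k * h))"
  have W: "W x = (\<Sum>k<n. \<theta> ^ k *\<^sub>R T (real k * h) x)" for x
    by (simp add: W_def blinfun.sum_left blinfun.scaleR_left)
  have RT: "R (T (real k * h) x) = T (real k * h) (R x)" for k x
    using h by (intro resolvent_commute_T[OF resolvent_at_1]) simp
  have WR: "W (R x) = R (W x)" for x
    by (simp add: W blinfun.sum_right blinfun.scaleR_right RT)
  have WN: "W (N x) = N (W x)" for x
    by (simp add: N WR blinfun.bilinear_simps)
  \<comment> \<open>The approximate inverse of \<open>N\<close>: the factor \<open>2 I - N\<close>
    leaves the defect \<open>(1 - a)\<^sup>2 R\<^sup>2\<close>, which the term with \<open>W\<close>
    compensates up to a small error.\<close>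
  define Z where "Z = 2 *\<^sub>R id_blinfun - N + ((1 - a)\<^sup>2 * (h * \<theta>)) *\<^sub>R (W o\<^sub>L R)"
  have Z: "Z x = 2 *\<^sub>R x - N x + ((1 - a)\<^sup>2 * (h * \<theta>)) *\<^sub>R W (R x)" for x
    by (simp add: Z_def blinfun.bilinear_simps)
  have NR: "N (R x) = R (N x)" for x by (simp add: N blinfun.bilinear_simps)
  have NZ: "N (Z x) = Z (N x)" for x
    unfolding Z by (simp add: blinfun.bilinear_simps NR WN[symmetric])
  define e where "e x = (1 / h) *\<^sub>R (T h (R (R x)) - R (R x)) - (R (R x) - R x)" for x
  have e: "norm (e x) \<le> h * C * norm x" for x
    unfolding e_def C_def by (rule quotient_R_square[OF h(1)])
  \<comment> \<open>Discounted summation of the one-step identity \<open>st\<close>: applying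
    \<open>W\<close> telescopes the left side to the values at times 0 and \<open>s\<close>.\<close>
  have RR: "R (R x) = \<theta> ^ n *\<^sub>R T s (R (R x)) + (h * \<theta>) *\<^sub>R W (N (R x)) - (h * \<theta>) *\<^sub>R W (e x)" for x
  proof -
    let ?u = "R (R x)"
    have st: "?u - \<theta> *\<^sub>R T h ?u = (h * \<theta>) *\<^sub>R (N (R x) - e x)"
    proof -
      have Th: "T h ?u = ?u + h *\<^sub>R (e x + (?u - R x))" using h by (simp add: e_def algebra_simps)
      have "?u - \<theta> *\<^sub>R T h ?u = (1 - \<theta>) *\<^sub>R ?u - (h * \<theta>) *\<^sub>R (e x + (?u - R x))"
        unfolding Th by (simp add: algebra_simps)
      also have "1 - \<theta> = (h * \<theta>) * a" using \<theta>(3) by (simp add: algebra_simps)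
      finally show ?thesis by (simp add: N algebra_simps)
    qed
    have "W (?u - \<theta> *\<^sub>R T h ?u) = (\<Sum>k<n. \<theta> ^ k *\<^sub>R T (real k * h) ?u - \<theta> ^ Suc k *\<^sub>R T (real (Suc k) * h) ?u)"
      unfolding W
    proof (rule sum.cong)
      fix k
      have "T (real k * h + h) ?u = T (real k * h) (T h ?u)" using h by (intro T_add) auto
      then show "\<theta> ^ k *\<^sub>R T (real k * h) (?u - \<theta> *\<^sub>R T h ?u)
          = \<theta> ^ k *\<^sub>R T (real k * h) ?u - \<theta> ^ Suc k *\<^sub>R T (real (Suc k) * h) ?u"
        by (simp add: blinfun.bilinear_simps algebra_simps)
    qed simp
    also have "\<dots> = ?u - \<theta> ^ n *\<^sub>R T s ?u"
      using sum_lessThan_telescope'[of "\<lambda>k. \<theta> ^ k *\<^sub>R T (real k * h) ?u" n] h by (simp add: T_0)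
    finally have "W ((h * \<theta>) *\<^sub>R (N (R x) - e x)) = ?u - \<theta> ^ n *\<^sub>R T s ?u" unfolding st .
    then show ?thesis by (simp add: blinfun.bilinear_simps algebra_simps)
  qed
  define D where "D = id_blinfun - (N o\<^sub>L Z)"
  have D: "D x = (1 - a)\<^sup>2 *\<^sub>R (\<theta> ^ n *\<^sub>R T s (R (R x)) - (h * \<theta>) *\<^sub>R W (e x))" for x
  proof -
    have "x - (2 *\<^sub>R N x - N (N x)) = (1 - a)\<^sup>2 *\<^sub>R R (R x)"
    proof -
      define b where "b = 1 - a"
      show ?thesis
        unfolding N b_def[symmetric]
        by (simp add: blinfun.bilinear_simps power2_eq_square algebra_simps scaleR_2)
          (simp only: mult_2 mult_2_right scaleR_add_left)
    qed
    moreover have "D x = x - (2 *\<^sub>R N x - N (N x)) - (1 - a)\<^sup>2 *\<^sub>R ((h * \<theta>) *\<^sub>R W (N (R x)))"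
      by (simp add: D_def Z blinfun.bilinear_simps WN)
    ultimately have "D x = (1 - a)\<^sup>2 *\<^sub>R (R (R x) - (h * \<theta>) *\<^sub>R W (N (R x)))"
      by (simp add: scaleR_diff_right)
    moreover have "R (R x) - (h * \<theta>) *\<^sub>R W (N (R x)) = \<theta> ^ n *\<^sub>R T s (R (R x)) - (h * \<theta>) *\<^sub>R W (e x)"
      by (subst RR[of x]) simp
    ultimately show ?thesis by simp
  qed
  have "norm (D x) \<le> 1 / 2 * norm x" for x
  proof -
    have "norm (\<theta> ^ n *\<^sub>R T s (R (R x))) \<le> 1 / 4 * norm x"
    proof -
      have "norm (\<theta> ^ n *\<^sub>R T s (R (R x))) \<le> 1 * norm (T s (R (R x)))"
        using \<theta> by (simp add: mult_left_le_one_le power_le_one)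
      also have "\<dots> \<le> norm (T s o\<^sub>L R) * (norm R * norm x)"
        using norm_blinfun[of "T s o\<^sub>L R" "R x"] norm_blinfun[of R x]
        by (simp add: mult_left_mono order_trans)
      also have "\<dots> \<le> 1 / (4 * (norm R + 1)) * ((norm R + 1) * norm x)"
        by (intro mult_mono s) auto
      also have "\<dots> = 1 / 4 * norm x"
      proof -
        have "1 / (4 * r) * (r * y) = 1 / 4 * y" if "r \<noteq> 0" for r y :: real using that by simp
        moreover have "norm R + 1 \<noteq> 0" by (smt (verit) norm_ge_zero)
        ultimately show ?thesis by blast
      qed
      finally show ?thesis .
    qed
    moreover have "norm ((h * \<theta>) *\<^sub>R W (e x)) \<le> 1 / 4 * norm x"
    proof -
      have "norm (W (e x)) \<le> (\<Sum>k<n. K * norm (e x))"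
        unfolding W
      proof (rule sum_norm_le)
        fix k
        have "norm (\<theta> ^ k *\<^sub>R T (real k * h) (e x)) \<le> norm (T (real k * h) (e x))"
          using \<theta> by (simp add: mult_left_le_one_le power_le_one)
        also have "\<dots> \<le> K * norm (e x)" using h by (intro T_bound) auto
        finally show "norm (\<theta> ^ k *\<^sub>R T (real k * h) (e x)) \<le> K * norm (e x)" .
      qed
      then have "norm ((h * \<theta>) *\<^sub>R W (e x)) \<le> (h * 1) * (real n * (K * norm (e x)))"
        using \<theta> h unfolding norm_scaleR by (intro mult_mono) auto
      also have "\<dots> = s * K * norm (e x)" using h by (simp add: mult_ac)
      also have "\<dots> \<le> s * K * (h * C * norm x)" using s K by (intro mult_left_mono e) auto
      also have "\<dots> = s * K * C * h * norm x" by (simp add: mult_ac)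
      also have "\<dots> \<le> 1 / 4 * norm x" by (intro mult_right_mono small) auto
      finally show ?thesis .
    qed
    ultimately have *: "norm (\<theta> ^ n *\<^sub>R T s (R (R x)) - (h * \<theta>) *\<^sub>R W (e x)) \<le> 1 / 2 * norm x"
      using norm_triangle_ineq4[of "\<theta> ^ n *\<^sub>R T s (R (R x))" "(h * \<theta>) *\<^sub>R W (e x)"] by linarith
    have "(1 - a)\<^sup>2 \<le> 1" using a by (simp add: power_le_one)
    then have "norm (D x) \<le> 1 * norm (\<theta> ^ n *\<^sub>R T s (R (R x)) - (h * \<theta>) *\<^sub>R W (e x))"
      unfolding D norm_scaleR by (intro mult_right_mono) auto
    with * show ?thesis by linarith
  qed
  then have "norm D \<le> 1 / 2" by (intro norm_blinfun_bound) auto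
  then have "norm (blinfun_pow D m) \<le> (1 / 2) ^ m" for m
    by (intro order_trans[OF norm_blinfun_pow power_mono]) auto
  then have "summable (\<lambda>m. norm (blinfun_pow D m))"
    by (intro summable_comparison_test'[OF summable_geometric[of "1 / 2 :: real"]]) auto
  from neumann_inverse[OF this] obtain S :: "'a \<Rightarrow>\<^sub>L 'a" where
    "\<And>x. blinfun_apply S (x - D x) = x" "\<And>x. blinfun_apply S x - D (S x) = x" by blast
  then have S: "S (N (Z x)) = x" "N (Z (S x)) = x" for x
    by (auto simp: D_def blinfun.bilinear_simps)
  \<comment> \<open>\<open>S\<close> inverts \<open>N Z\<close> on both sides; as \<open>N\<close>
    and \<open>Z\<close> commute, \<open>Z S\<close> is also a left inverse of
    \<open>N\<close>.\<close>
  have ZS: "Z (S (N x)) = x" for x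
    using S(1)[of "Z (S (N x))"] S(1)[of x] by (simp add: NZ S(2)) (metis NZ S(2))
  have "resolvent_at a (R o\<^sub>L Z o\<^sub>L S)"
    unfolding resolvent_at_def bounded_inverse_of_def
  proof (intro conjI allI ballI)
    fix x
    show "(R o\<^sub>L Z o\<^sub>L S) x \<in> gen_dom T" by (simp add: R_dom)
    have "a *\<^sub>R R y - gen T (R y) = N y" for y by (simp add: gen_R N algebra_simps)
    then show "a *\<^sub>R (R o\<^sub>L Z o\<^sub>L S) x - gen T ((R o\<^sub>L Z o\<^sub>L S) x) = x" by (simp add: S)
  next
    fix x assume x: "x \<in> gen_dom T"
    let ?u = "x - gen T x"
    have Ru: "R ?u = x" using resolvent_atD(3)[OF resolvent_at_1 x] by simp
    have "a *\<^sub>R x - gen T x = N ?u" unfolding N Ru by (simp add: algebra_simps)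
    then show "(R o\<^sub>L Z o\<^sub>L S) (a *\<^sub>R x - gen T x) = x" by (simp add: ZS Ru)
  qed
  then show ?thesis by blast
qed

text \<open>The error is \<open>X h\<close> applied to the difference between the quotient and the
  generator at \<open>Y z\<close>. That vector tends to 0 because \<open>Y z\<close> is in the
  domain, and \<open>X h\<close> is uniformly bounded.\<close>

lemma quot_resolvent_tendsto:
  assumes Y: "resolvent_at a Y" and X: "\<And>h. h > 0 \<Longrightarrow> quot_resolvent h (T h) a (X h)"
    and C: "\<And>h. h > 0 \<Longrightarrow> norm (X h) \<le> C"
  shows "((\<lambda>h. X h z) \<longlongrightarrow> Y z) (at_right 0)"
proof -
  let ?q = "\<lambda>h. (1 / h) *\<^sub>R (T h (Y z) - Y z)"
  have bd: "norm (X h z - Y z) \<le> C * norm (?q h - gen T (Y z))" if "h > 0" for h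
  proof -
    have "h *\<^sub>R Y z = X h ((1 + a * h) *\<^sub>R Y z - T h (Y z))"
      using X[OF that] by (simp add: quot_resolvent_def)
    also have "(1 + a * h) *\<^sub>R Y z - T h (Y z) = h *\<^sub>R (a *\<^sub>R Y z - ?q h)"
      using that by (simp add: scaleR_diff_right scaleR_add_left mult.commute)
    finally have "Y z = X h (a *\<^sub>R Y z - ?q h)" using that by (simp add: blinfun.scaleR_right)
    then have "X h z - Y z = X h (z - (a *\<^sub>R Y z - ?q h))" by (simp add: blinfun.diff_right)
    also have "z - (a *\<^sub>R Y z - ?q h) = ?q h - gen T (Y z)"
      by (simp add: resolvent_atD(2)[OF Y])
    finally have eq: "X h z - Y z = X h (?q h - gen T (Y z))" .
    show ?thesis unfolding eq
      by (intro order_trans[OF norm_blinfun] mult_right_mono C that norm_ge_zero)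
  qed
  have "((\<lambda>h. C * norm (?q h - gen T (Y z))) \<longlongrightarrow> C * norm (gen T (Y z) - gen T (Y z))) (at_right 0)"
    by (intro tendsto_intros gen_tendsto resolvent_atD(1)[OF Y])
  then have "((\<lambda>h. C * norm (?q h - gen T (Y z))) \<longlongrightarrow> 0) (at_right 0)" by simp
  then have "((\<lambda>h. X h z - Y z) \<longlongrightarrow> 0) (at_right 0)"
    by (rule Lim_null_comparison[rotated])
       (use bd eventually_at_right_less[of 0] in \<open>auto elim: eventually_mono\<close>)
  then show ?thesis by (rule LIM_zero_cancel)
qed

subsection \<open>From the difference quotients to the generator\<close>

lemma quot_resolvents_exist:
  assumes a: "a > 0"
  obtains X where "\<And>h. h > 0 \<Longrightarrow> quot_resolvent h (T h) a (X h)" "\<And>h. h > 0 \<Longrightarrow> norm (X h) \<le> K / a"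
proof -
  have "\<exists>X. quot_resolvent h (T h) a X \<and> norm X \<le> K / a" if "h > 0" for h
    using K a that by (intro quot_resolvent_exists T_pow_bound) auto
  then show ?thesis using that by metis
qed

text \<open>\<open>X h\<close> and \<open>Y\<close> commute, so \<open>exp_flow_diff_bound\<close>
  reduces the claim to strong convergence of \<open>X h\<close>; the uniform norm bound keeps the
  exponential factor fixed.\<close>

lemma quot_flow_tendsto:
  assumes Y: "resolvent_at a Y" and X: "\<And>h. h > 0 \<Longrightarrow> quot_resolvent h (T h) a (X h)"
    and C: "\<And>h. h > 0 \<Longrightarrow> norm (X h) \<le> C" and t: "0 \<le> t"
  shows "((\<lambda>h. blinfun_exp ((- t) *\<^sub>R X h) z) \<longlongrightarrow> blinfun_exp ((- t) *\<^sub>R Y) z) (at_right 0)"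
proof -
  have bd: "norm (blinfun_exp ((- t) *\<^sub>R X h) z - blinfun_exp ((- t) *\<^sub>R Y) z)
      \<le> t * exp (t * (C + norm Y)) * norm (X h z - Y z)" if h: "h > 0" for h
  proof -
    have "Y (X h x) = X h (Y x)" for x
      using h by (intro quot_resolvent_commute[OF X[OF h]] resolvent_commute_T[OF Y]) auto
    then have "norm (blinfun_exp ((- t) *\<^sub>R X h) z - blinfun_exp ((- t) *\<^sub>R Y) z)
        \<le> t * exp (t * (norm (X h) + norm Y)) * norm (X h z - Y z)"
      by (intro exp_flow_diff_bound t) simp
    also have "\<dots> \<le> t * exp (t * (C + norm Y)) * norm (X h z - Y z)"
      using C[OF h] t by (intro mult_right_mono mult_left_mono) (auto intro: mult_left_mono)
    finally show ?thesis .
  qed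
  have "((\<lambda>h. t * exp (t * (C + norm Y)) * norm (X h z - Y z)) \<longlongrightarrow> t * exp (t * (C + norm Y)) * norm (Y z - Y z)) (at_right 0)"
    by (intro tendsto_intros quot_resolvent_tendsto[OF Y X C])
  then have "((\<lambda>h. t * exp (t * (C + norm Y)) * norm (X h z - Y z)) \<longlongrightarrow> 0) (at_right 0)" by simp
  then have "((\<lambda>h. blinfun_exp ((- t) *\<^sub>R X h) z - blinfun_exp ((- t) *\<^sub>R Y) z) \<longlongrightarrow> 0) (at_right 0)"
    by (rule Lim_null_comparison[rotated])
       (use bd eventually_at_right_less[of 0] in \<open>auto elim: eventually_mono\<close>)
  then show ?thesis by (rule LIM_zero_cancel)
qed

text \<open>The starting value of the dyadic chain: the case \<open>a = 1\<close> of
  \<open>resolvent_flow_bound\<close>, in the limit of small \<open>h\<close>.\<close>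

lemma exp_flow_R_bound:
  assumes t: "0 \<le> t"
  shows "norm (blinfun_exp ((- t) *\<^sub>R R) (R z)) \<le> 2 * K * norm z"
proof -
  obtain X where X: "\<And>h. h > 0 \<Longrightarrow> quot_resolvent h (T h) 1 (X h)" and C: "\<And>h. h > 0 \<Longrightarrow> norm (X h) \<le> K / 1"
    using quot_resolvents_exist[of 1] by auto
  let ?E = "\<lambda>h. blinfun_exp ((- t) *\<^sub>R X h)"
  have bd: "norm (?E h (R z)) \<le> 2 * K * norm z + exp (t * K) * norm (X h z - R z)" if h: "h > 0" for h
  proof -
    have "X h (?E h z) = ?E h (X h z)"
      by (rule blinfun_exp_commute) (simp add: blinfun.bilinear_simps)
    moreover have "norm (X h (?E h z)) \<le> 2 * K / 1 * norm z"
      using h by (intro resolvent_flow_bound[OF T_pow_bound K X _ _ t]) auto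
    ultimately have 1: "norm (?E h (X h z)) \<le> 2 * K * norm z" by simp
    have "norm (?E h) \<le> exp (t * K)"
      using C[OF h] t by (intro order_trans[OF norm_blinfun_exp]) (auto intro: mult_left_mono)
    then have 2: "norm (?E h (X h z - R z)) \<le> exp (t * K) * norm (X h z - R z)"
      by (intro order_trans[OF norm_blinfun] mult_right_mono) auto
    \<comment> \<open>The uniform estimate covers the flow on the range of \<open>X h\<close>, not
      of \<open>R\<close>. The correction grows with \<open>t\<close> but vanishes as
      \<open>h\<close> tends to 0 for fixed \<open>t\<close>.\<close>
    have "?E h (R z) = ?E h (X h z) - ?E h (X h z - R z)" by (simp add: blinfun.diff_right)
    with 1 2 norm_triangle_ineq4[of "?E h (X h z)" "?E h (X h z - R z)"] show ?thesis by simp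
  qed
  have "((\<lambda>h. 2 * K * norm z + exp (t * K) * norm (X h z - R z)) \<longlongrightarrow> 2 * K * norm z + exp (t * K) * norm (R z - R z)) (at_right 0)"
    by (intro tendsto_intros quot_resolvent_tendsto[OF resolvent_at_1 X C])
  moreover have "((\<lambda>h. norm (?E h (R z))) \<longlongrightarrow> norm (blinfun_exp ((- t) *\<^sub>R R) (R z))) (at_right 0)"
    by (intro tendsto_intros quot_flow_tendsto[OF resolvent_at_1 X C t])
  ultimately have "norm (blinfun_exp ((- t) *\<^sub>R R) (R z)) \<le> 2 * K * norm z + exp (t * K) * norm (R z - R z)"
    by (rule tendsto_le[rotated])
       (use bd eventually_at_right_less[of 0] in \<open>auto elim: eventually_mono\<close>)
  then show ?thesis by simp
qed

text \<open>The times before \<open>L\<close> are estimated by boundedness of the semigroup, the later ones by decay.\<close>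

lemma orbit_energy_bound:
  assumes b: "b > 0" and h: "0 < h" "h \<le> L"
    and m: "\<And>s. s \<ge> L \<Longrightarrow> norm (T s o\<^sub>L R) \<le> m"
  shows "h / (1 + b * h) * energy (T h) ((1 / (1 + b * h))\<^sup>2) N (R z) (R z)
    \<le> (2 * L * (K * norm R)\<^sup>2 + m\<^sup>2 / b) * (norm z)\<^sup>2"
proof -
  define \<theta> where "\<theta> = 1 / (1 + b * h)"
  note d = discount_bounds[OF b h(1), folded \<theta>_def]
  have q: "0 \<le> \<theta>\<^sup>2" "\<theta>\<^sup>2 < 1" using d by (auto simp: abs_square_less_1)
  define A where "A = (K * norm R * norm z)\<^sup>2"
  define B where "B = (m * norm z)\<^sup>2"
  have nn: "0 \<le> A" "0 \<le> B" by (simp_all add: A_def B_def)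
  have m0: "0 \<le> m" using order_trans[OF norm_ge_zero m[of L]] by simp
  \<comment> \<open>The indices of sampling times before \<open>L\<close>; there are at most
    \<open>L / h + 1\<close> of them, and their weights are estimated by 1.\<close>
  define I where "I = {n. n < N \<and> real n * h < L}"
  have each: "(\<theta>\<^sup>2) ^ n * (blinfun_pow (T h) n (R z) \<bullet> blinfun_pow (T h) n (R z))
      \<le> (if n \<in> I then A else 0) + (\<theta>\<^sup>2) ^ n * B" if n: "n < N" for n
  proof -
    have nh: "0 \<le> real n * h" using h by simp
    have "(norm (T (real n * h) (R z)))\<^sup>2 \<le> (if n \<in> I then A else 0) + B"
    proof (cases "real n * h < L")
      case True
      have "norm (T (real n * h) (R z)) \<le> K * (norm R * norm z)"
        using K by (intro order_trans[OF T_bound[OF nh]] mult_left_mono norm_blinfun) auto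
      then have "(norm (T (real n * h) (R z)))\<^sup>2 \<le> A"
        unfolding A_def by (intro power_mono) (auto simp: mult.assoc)
      with True n nn show ?thesis by (auto simp: I_def)
    next
      case False
      have "norm (T (real n * h) (R z)) \<le> m * norm z"
        using norm_blinfun[of "T (real n * h) o\<^sub>L R" z] m[of "real n * h"] False
        by (simp add: mult_right_mono order_trans)
      then have "(norm (T (real n * h) (R z)))\<^sup>2 \<le> B"
        unfolding B_def by (intro power_mono) auto
      with nn show ?thesis by auto
    qed
    then have "(\<theta>\<^sup>2) ^ n * (norm (T (real n * h) (R z)))\<^sup>2 \<le> (\<theta>\<^sup>2) ^ n * ((if n \<in> I then A else 0) + B)"
      by (intro mult_left_mono) auto
    also have "\<dots> \<le> (if n \<in> I then A else 0) + (\<theta>\<^sup>2) ^ n * B"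
      using nn q by (simp add: distrib_left mult_left_le_one_le power_le_one)
    finally show ?thesis using h by (simp add: T_pow power2_norm_eq_inner)
  qed
  have "energy (T h) (\<theta>\<^sup>2) N (R z) (R z) \<le> (\<Sum>n<N. (if n \<in> I then A else 0) + (\<theta>\<^sup>2) ^ n * B)"
    unfolding energy_def by (intro sum_mono each) simp
  also have "\<dots> = real (card I) * A + (1 - (\<theta>\<^sup>2) ^ N) / (1 - \<theta>\<^sup>2) * B"
  proof -
    have "{..<N} \<inter> I = I" by (auto simp: I_def)
    moreover have "(\<Sum>n<N. if n \<in> I then A else 0) = real (card ({..<N} \<inter> I)) * A"
      by (simp add: sum.inter_restrict[symmetric])
    ultimately show ?thesis
      using q by (simp add: sum.distrib sum_distrib_right[symmetric] sum_gp_strict)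
  qed
  also have "\<dots> \<le> (L / h + 1) * A + 1 / (1 - \<theta>\<^sup>2) * B"
  proof (intro add_mono mult_right_mono)
    have "I \<subseteq> {..<nat \<lceil>L / h\<rceil>}"
      using h by (auto simp: I_def field_simps zless_nat_eq_int_zless less_ceiling_iff)
    then have "card I \<le> nat \<lceil>L / h\<rceil>" by (metis card_lessThan card_mono finite_lessThan)
    moreover have "real (nat \<lceil>L / h\<rceil>) \<le> L / h + 1" using h by (simp add: of_nat_nat)
    ultimately show "real (card I) \<le> L / h + 1" by linarith
    show "(1 - (\<theta>\<^sup>2) ^ N) / (1 - \<theta>\<^sup>2) \<le> 1 / (1 - \<theta>\<^sup>2)" using q by (intro divide_right_mono) auto
  qed (use nn in auto)
  finally have "h * \<theta> * energy (T h) (\<theta>\<^sup>2) N (R z) (R z) \<le> h * \<theta> * ((L / h + 1) * A + 1 / (1 - \<theta>\<^sup>2) * B)"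
    using h d by (intro mult_left_mono) auto
  also have "\<dots> = \<theta> * ((L + h) * A) + h * \<theta> / (1 - \<theta>\<^sup>2) * B"
    using h by (simp add: field_simps)
  \<comment> \<open>Here \<open>h \<le> L\<close> absorbs the extra sampling point into
    \<open>2 * L\<close>.\<close>
  also have "\<dots> \<le> 1 * ((2 * L) * A) + 1 / b * B"
    using h d nn b by (intro add_mono mult_mono) auto
  also have "\<dots> = (2 * L * (K * norm R)\<^sup>2 + m\<^sup>2 / b) * (norm z)\<^sup>2"
    by (simp add: A_def B_def power_mult_distrib algebra_simps)
  finally show ?thesis by (simp add: \<theta>_def)
qed

text \<open>The bound on difference quotients survives the limit in weak form, for each fixed
  \<open>y\<close>; a suitable \<open>y\<close> then recovers the norm.\<close>

lemma flow_step_bound: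
  assumes X: "resolvent_at a X" and Y: "resolvent_at b Y"
    and pos: "a > 0" "b > 0" "\<epsilon> > 0" "L > 0" and t: "0 \<le> t"
    and m: "\<And>s. s \<ge> L \<Longrightarrow> norm (T s o\<^sub>L R) \<le> m"
  shows "norm (blinfun_exp ((- t) *\<^sub>R X) (R z) - blinfun_exp ((- t) *\<^sub>R Y) (R z))
    \<le> \<bar>a - b\<bar> * (\<epsilon> * (2 * L * (K * norm R)\<^sup>2 + m\<^sup>2 / b) + K\<^sup>2 / (a * \<epsilon>)) * norm z"
proof -
  let ?D = "blinfun_exp ((- t) *\<^sub>R X) (R z) - blinfun_exp ((- t) *\<^sub>R Y) (R z)"
  let ?v = "(2 * L * (K * norm R)\<^sup>2 + m\<^sup>2 / b) * (norm z)\<^sup>2"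
  obtain Xh where Xh: "\<And>h. h > 0 \<Longrightarrow> quot_resolvent h (T h) a (Xh h)" "\<And>h. h > 0 \<Longrightarrow> norm (Xh h) \<le> K / a"
    using quot_resolvents_exist[OF pos(1)] by blast
  obtain Yh where Yh: "\<And>h. h > 0 \<Longrightarrow> quot_resolvent h (T h) b (Yh h)" "\<And>h. h > 0 \<Longrightarrow> norm (Yh h) \<le> K / b"
    using quot_resolvents_exist[OF pos(2)] by blast
  have weak: "\<bar>?D \<bullet> y\<bar> \<le> \<bar>a - b\<bar> * (\<epsilon> * ?v + K\<^sup>2 * (norm y)\<^sup>2 / (a * \<epsilon>))" for y
  proof (rule tendsto_upperbound)
    show "((\<lambda>h. \<bar>(blinfun_exp ((- t) *\<^sub>R Xh h) (R z) - blinfun_exp ((- t) *\<^sub>R Yh h) (R z)) \<bullet> y\<bar>)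
        \<longlongrightarrow> \<bar>?D \<bullet> y\<bar>) (at_right 0)"
      by (intro tendsto_intros quot_flow_tendsto[OF X Xh t] quot_flow_tendsto[OF Y Yh t])
    have "eventually (\<lambda>h. 0 < h \<and> h < L) (at_right 0)"
      unfolding eventually_at_right_field using pos(4) by (intro exI[of _ L]) simp
    then show "eventually (\<lambda>h. \<bar>(blinfun_exp ((- t) *\<^sub>R Xh h) (R z) - blinfun_exp ((- t) *\<^sub>R Yh h) (R z)) \<bullet> y\<bar>
        \<le> \<bar>a - b\<bar> * (\<epsilon> * ?v + K\<^sup>2 * (norm y)\<^sup>2 / (a * \<epsilon>))) (at_right 0)"
    proof (rule eventually_mono)
      fix h assume h: "0 < h \<and> h < L"
      then show "\<bar>(blinfun_exp ((- t) *\<^sub>R Xh h) (R z) - blinfun_exp ((- t) *\<^sub>R Yh h) (R z)) \<bullet> y\<bar>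
        \<le> \<bar>a - b\<bar> * (\<epsilon> * ?v + K\<^sup>2 * (norm y)\<^sup>2 / (a * \<epsilon>))"
        by (intro flow_difference_bound[OF T_pow_bound Xh(1) Yh(1) pos(1,2) _ pos(3) t]
            orbit_energy_bound[OF pos(2) _ _ m]) auto
    qed
  qed simp
  show ?thesis
  proof (cases "?D = 0 \<or> z = 0")
    case True
    have "0 \<le> \<bar>a - b\<bar> * (\<epsilon> * (2 * L * (K * norm R)\<^sup>2 + m\<^sup>2 / b) + K\<^sup>2 / (a * \<epsilon>)) * norm z"
      using pos by (intro mult_nonneg_nonneg add_nonneg_nonneg divide_nonneg_nonneg) auto
    with True show ?thesis by (auto simp: blinfun.zero_right)
  next
    case False
    \<comment> \<open>Aligned with the difference and scaled to the norm of \<open>z\<close>, so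
      that both terms on the right become multiples of the same square.\<close>
    define y where "y = (norm z / norm ?D) *\<^sub>R ?D"
    have "norm y = norm z" using False by (simp add: y_def)
    moreover have "?D \<bullet> y = norm z * norm ?D"
    proof -
      have "?D \<bullet> y = norm z / norm ?D * (?D \<bullet> ?D)" unfolding y_def by (rule inner_scaleR_right)
      then show ?thesis using False by (simp only: dot_square_norm) (simp add: power2_eq_square)
    qed
    ultimately have "norm z * norm ?D \<le> \<bar>a - b\<bar> * (\<epsilon> * ?v + K\<^sup>2 * (norm z)\<^sup>2 / (a * \<epsilon>))"
      using weak[of y] by simp
    also have "\<dots> = norm z * (\<bar>a - b\<bar> * (\<epsilon> * (2 * L * (K * norm R)\<^sup>2 + m\<^sup>2 / b) + K\<^sup>2 / (a * \<epsilon>)) * norm z)"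
    proof -
      have alg: "r * (e * (u * n\<^sup>2) + k * n\<^sup>2 / s) = n * (r * (e * u + k / s) * n)" for r e u n k s :: real
      proof -
        have "e * (u * n\<^sup>2) + k * n\<^sup>2 / s = (e * u + k / s) * n\<^sup>2" by (simp add: distrib_right)
        then show ?thesis by (simp only: power2_eq_square mult_ac)
      qed
      show ?thesis by (rule alg)
    qed
    finally show ?thesis by (rule mult_left_le_imp_le) (use False in simp)
  qed
qed

section \<open>Summation over the dyadic parameters\<close>

text \<open>For \<open>b = 1 / 2 ^ k\<close> and \<open>L = sqrt (2 ^ k)\<close> the times before
  \<open>L\<close> contribute in proportion to \<open>b * L\<close>, which is geometrically small.
  Each halving of the parameter thus costs a geometric term plus a multiple of \<open>m\<close>, and
  both are summable.\<close>

lemma inverse_generator_flow_bounded: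
  assumes m: "\<And>k s. s \<ge> sqrt (2 ^ k) \<Longrightarrow> norm (T s o\<^sub>L R) \<le> m k" and sm: "summable m"
  shows "\<exists>B. bounded_inverse_of (gen_dom T) (gen T) B \<and>
    (\<exists>C. \<forall>t\<ge>0. norm (blinfun_exp (t *\<^sub>R B) o\<^sub>L B) \<le> C)"
proof -
  have m0: "0 \<le> m k" for k using order_trans[OF norm_ge_zero m[of k "sqrt (2 ^ k)"]] by simp
  have decay: "\<exists>s>0. norm (T s o\<^sub>L R) \<le> e" if "e > 0" for e
  proof -
    have "eventually (\<lambda>k. m k < e) sequentially"
      using order_tendstoD(2)[OF summable_LIMSEQ_zero[OF sm] that] .
    then obtain k where "m k < e" using eventually_happens trivial_limit_sequentially by blast
    then show ?thesis using m[of k "sqrt (2 ^ k)"] by (intro exI[of _ "sqrt (2 ^ k)"]) auto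
  qed
  obtain Z where Z: "resolvent_at 0 Z" using resolvent_exists[OF _ _ decay, of 0] by auto
  define \<alpha> :: "nat \<Rightarrow> real" where "\<alpha> k = (1 / 2) ^ k" for k
  have \<alpha>: "0 < \<alpha> k" "\<alpha> k \<le> 1" "\<alpha> (Suc k) = \<alpha> k / 2" for k
    by (auto simp: \<alpha>_def power_le_one)
  have "\<exists>X. resolvent_at (\<alpha> k) X" for k
    using \<alpha>[of k] by (intro resolvent_exists decay) auto
  then obtain Q' where Q': "\<And>k. resolvent_at (\<alpha> k) (Q' k)" by metis
  \<comment> \<open>At index 0 the given resolvent is used itself, so that the induction starts from
    \<open>exp_flow_R_bound\<close>.\<close>
  define Q where "Q k = (if k = 0 then R else Q' k)" for k
  have Q: "resolvent_at (\<alpha> k) (Q k)" for k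
    using Q'[of k] resolvent_at_1 by (auto simp: Q_def \<alpha>_def)
  \<comment> \<open>A fourth root, so that
    \<open>\<alpha> k * sqrt (2 ^ k) = (q k)\<^sup>2\<close>.\<close>
  define q where "q k = sqrt (sqrt (\<alpha> k))" for k
  have q: "q k > 0" "(q k)\<^sup>2 = sqrt (\<alpha> k)" for k using \<alpha>[of k] by (auto simp: q_def)
  define c where "c = 2 * (K * norm R)\<^sup>2 + 1 + K\<^sup>2"
  define d where "d k = c * (q (Suc k) + m (Suc k))" for k
  have sd: "summable d"
  proof -
    have "q k = sqrt (sqrt (1 / 2)) ^ k" for k by (simp add: q_def \<alpha>_def real_sqrt_power)
    moreover have "summable (\<lambda>k. sqrt (sqrt (1 / 2)) ^ k)" by (rule summable_geometric) simp
    ultimately have "summable q" by presburger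
    then show ?thesis unfolding d_def
      by (intro summable_mult summable_add) (use sm in \<open>simp_all add: summable_Suc_iff\<close>)
  qed
  have d0: "0 \<le> d k" for k
    unfolding d_def c_def using q[of "Suc k"] m0[of "Suc k"]
    by (intro mult_nonneg_nonneg add_nonneg_nonneg) auto
  have step: "norm (blinfun_exp ((- t) *\<^sub>R Q k) (R z) - blinfun_exp ((- t) *\<^sub>R Q (Suc k)) (R z)) \<le> d k * norm z"
    if t: "0 \<le> t" for t k z
  proof -
    let ?b = "\<alpha> (Suc k)" and ?q = "q (Suc k)" and ?m = "m (Suc k)"
    define L where "L = sqrt (2 ^ Suc k)"
    \<comment> \<open>Balances the two sides of Young's inequality: with this choice
      \<open>\<epsilon> * ?q\<^sup>2\<close>, \<open>\<epsilon> * ?m\<^sup>2\<close> and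
      \<open>1 / \<epsilon>\<close> are all at most \<open>?q + ?m\<close>.\<close>
    define \<epsilon> where "\<epsilon> = 1 / (?q + ?m)"
    have qm: "?q + ?m > 0" using q[of "Suc k"] m0[of "Suc k"] by linarith
    have \<epsilon>: "\<epsilon> > 0" "1 / \<epsilon> = ?q + ?m" using qm by (simp_all add: \<epsilon>_def)
    have bL: "?b * L = ?q\<^sup>2"
    proof -
      have "?b * L = sqrt ?b * (sqrt ?b * L)" using \<alpha>[of "Suc k"] by (simp add: mult.assoc[symmetric])
      moreover have "sqrt ?b * L = sqrt (?b * 2 ^ Suc k)" unfolding L_def by (simp add: real_sqrt_mult)
      moreover have "?b * 2 ^ Suc k = 1" unfolding \<alpha>_def by (simp add: power_divide)
      ultimately show ?thesis by (simp add: q(2))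
    qed
    have "\<bar>\<alpha> k - ?b\<bar> * (\<epsilon> * (2 * L * (K * norm R)\<^sup>2 + ?m\<^sup>2 / ?b) + K\<^sup>2 / (\<alpha> k * \<epsilon>))
        = \<epsilon> * (2 * (?b * L) * (K * norm R)\<^sup>2 + ?m\<^sup>2) + K\<^sup>2 / 2 * (1 / \<epsilon>)"
    proof -
      have alg: "b * (e * (2 * l * u + v / b) + w / (2 * b * e)) = e * (2 * (b * l) * u + v) + w / 2 * (1 / e)"
        if "b > 0" for b e l u v w :: real
        using that by (simp add: field_simps)
      have "\<alpha> k = 2 * ?b" "\<bar>2 * ?b - ?b\<bar> = ?b" using \<alpha>[of k] \<alpha>[of "Suc k"] by auto
      then show ?thesis by (simp only: alg[OF \<alpha>(1)])
    qed
    also have "\<dots> = 2 * (K * norm R)\<^sup>2 * (\<epsilon> * ?q\<^sup>2) + \<epsilon> * ?m\<^sup>2 + K\<^sup>2 / 2 * (?q + ?m)"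
      unfolding bL \<epsilon>(2) by (simp add: algebra_simps)
    also have "\<dots> \<le> 2 * (K * norm R)\<^sup>2 * (?q + ?m) + (?q + ?m) + K\<^sup>2 * (?q + ?m)"
    proof (intro add_mono mult_left_mono mult_right_mono)
      show "\<epsilon> * ?q\<^sup>2 \<le> ?q + ?m" and "\<epsilon> * ?m\<^sup>2 \<le> ?q + ?m"
      proof -
        have "?q\<^sup>2 \<le> (?q + ?m)\<^sup>2" "?m\<^sup>2 \<le> (?q + ?m)\<^sup>2"
          using q(1)[of "Suc k"] m0[of "Suc k"] by (auto intro!: power_mono)
        then show "\<epsilon> * ?q\<^sup>2 \<le> ?q + ?m" "\<epsilon> * ?m\<^sup>2 \<le> ?q + ?m"
          using qm by (simp_all add: \<epsilon>_def pos_divide_le_eq power2_eq_square[of "?q + ?m"])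
      qed
    qed (use qm in auto)
    also have "\<dots> = d k" by (simp add: d_def c_def algebra_simps)
    finally have le: "\<bar>\<alpha> k - ?b\<bar> * (\<epsilon> * (2 * L * (K * norm R)\<^sup>2 + ?m\<^sup>2 / ?b) + K\<^sup>2 / (\<alpha> k * \<epsilon>)) \<le> d k" .
    have "norm (blinfun_exp ((- t) *\<^sub>R Q k) (R z) - blinfun_exp ((- t) *\<^sub>R Q (Suc k)) (R z))
        \<le> \<bar>\<alpha> k - ?b\<bar> * (\<epsilon> * (2 * L * (K * norm R)\<^sup>2 + ?m\<^sup>2 / ?b) + K\<^sup>2 / (\<alpha> k * \<epsilon>)) * norm z"
      by (rule flow_step_bound[OF Q Q \<alpha>(1) \<alpha>(1) \<epsilon>(1) _ t m]) (simp_all add: L_def)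
    also have "\<dots> \<le> d k * norm z" by (intro mult_right_mono le) simp
    finally show ?thesis .
  qed
  define C where "C = 2 * K + suminf d"
  have Qbound: "norm (blinfun_exp ((- t) *\<^sub>R Q n) (R z)) \<le> C * norm z" if t: "0 \<le> t" for t n z
  proof -
    have "norm (blinfun_exp ((- t) *\<^sub>R Q n) (R z)) \<le> (2 * K + (\<Sum>k<n. d k)) * norm z"
    proof (induction n)
      case 0
      show ?case using exp_flow_R_bound[OF t, of z] by (simp add: Q_def)
    next
      case (Suc n)
      have "norm (blinfun_exp ((- t) *\<^sub>R Q (Suc n)) (R z))
        \<le> norm (blinfun_exp ((- t) *\<^sub>R Q n) (R z)) + norm (blinfun_exp ((- t) *\<^sub>R Q n) (R z) - blinfun_exp ((- t) *\<^sub>R Q (Suc n)) (R z))"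
        by (metis norm_minus_commute norm_triangle_sub)
      with Suc step[OF t, of n z] show ?case by (simp add: algebra_simps)
    qed
    also have "\<dots> \<le> C * norm z"
      unfolding C_def by (intro mult_right_mono add_left_mono sum_le_suminf sd) (auto simp: d0)
    finally show ?thesis .
  qed
  have Zbound: "norm (blinfun_exp ((- t) *\<^sub>R Z) (R z)) \<le> C * norm z" if t: "0 \<le> t" for t z
  proof -
    have \<alpha>0: "\<alpha> \<longlonglongrightarrow> 0" unfolding \<alpha>_def by (intro LIMSEQ_realpow_zero) auto
    define w where "w = R z"
    \<comment> \<open>A bound of order \<open>1 / \<alpha> k\<close> would not survive the limit.
      The resolvent identity against \<open>Z\<close> gives a uniform one, by absorbing half of
      \<open>norm (Q k)\<close>.\<close>
    have Qnorm: "norm (Q k) \<le> 2 * norm Z" if "\<alpha> k * norm Z \<le> 1 / 2" for k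
    proof -
      have "norm (Q k) \<le> norm Z + \<alpha> k * norm Z * norm (Q k)"
      proof (rule norm_blinfun_bound)
        fix x
        have "Q k x = Z x - \<alpha> k *\<^sub>R Q k (Z x)"
          using resolvent_identity[OF Q[of k] Z, of x] by (simp add: algebra_simps)
        then have "norm (Q k x) \<le> norm (Z x) + norm (\<alpha> k *\<^sub>R Q k (Z x))" by (metis norm_triangle_ineq4)
        also have "\<dots> \<le> norm Z * norm x + \<alpha> k * (norm (Q k) * (norm Z * norm x))"
          using \<alpha>[of k] unfolding norm_scaleR
          by (intro add_mono mult_mono norm_blinfun order_trans[OF norm_blinfun] mult_left_mono) auto
        finally show "norm (Q k x) \<le> (norm Z + \<alpha> k * norm Z * norm (Q k)) * norm x"
          by (simp add: algebra_simps)
      qed (use \<alpha>[of k] in auto)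
      also have "\<alpha> k * norm Z * norm (Q k) \<le> 1 / 2 * norm (Q k)" by (intro mult_right_mono that) simp
      finally show ?thesis by simp
    qed
    have bd: "norm (blinfun_exp ((- t) *\<^sub>R Q k) w - blinfun_exp ((- t) *\<^sub>R Z) w)
        \<le> t * exp (t * (2 * norm Z + norm Z)) * (\<alpha> k * (2 * norm Z * norm (Z w)))"
      if k: "\<alpha> k * norm Z \<le> 1 / 2" for k
    proof -
      have comm: "Q k (Z x) = Z (Q k x)" for x
        using \<alpha>[of k] by (intro resolvents_commute[OF Q Z]) auto
      have "Q k w - Z w = (- \<alpha> k) *\<^sub>R Q k (Z w)" using resolvent_identity[OF Q[of k] Z, of w] by simp
      then have "norm (Q k w - Z w) = \<alpha> k * norm (Q k (Z w))" using \<alpha>[of k] by simp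
      also have "\<dots> \<le> \<alpha> k * (2 * norm Z * norm (Z w))"
        using \<alpha>[of k] by (intro mult_left_mono order_trans[OF norm_blinfun] mult_right_mono Qnorm k) auto
      finally have 1: "norm (Q k w - Z w) \<le> \<alpha> k * (2 * norm Z * norm (Z w))" .
      have 2: "t * exp (t * (norm (Q k) + norm Z)) \<le> t * exp (t * (2 * norm Z + norm Z))"
        using Qnorm[OF k] t by (intro mult_left_mono) (auto intro: mult_left_mono)
      show ?thesis
        by (rule order_trans[OF exp_flow_diff_bound[OF comm t] mult_mono[OF 2 1]]) (use t in auto)
    qed
    have "(\<lambda>k. \<alpha> k * norm Z) \<longlonglongrightarrow> 0 * norm Z" by (intro tendsto_intros \<alpha>0)
    then have ev: "eventually (\<lambda>k. \<alpha> k * norm Z < 1 / 2) sequentially" by (intro order_tendstoD) auto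
    have "(\<lambda>k. t * exp (t * (2 * norm Z + norm Z)) * (\<alpha> k * (2 * norm Z * norm (Z w))))
        \<longlonglongrightarrow> t * exp (t * (2 * norm Z + norm Z)) * (0 * (2 * norm Z * norm (Z w)))"
      by (intro tendsto_intros \<alpha>0)
    then have "(\<lambda>k. t * exp (t * (2 * norm Z + norm Z)) * (\<alpha> k * (2 * norm Z * norm (Z w)))) \<longlonglongrightarrow> 0"
      by simp
    then have "(\<lambda>k. blinfun_exp ((- t) *\<^sub>R Q k) w - blinfun_exp ((- t) *\<^sub>R Z) w) \<longlonglongrightarrow> 0"
      by (rule Lim_null_comparison[rotated]) (rule eventually_mono[OF ev], rule bd, simp)
    then have "(\<lambda>k. norm (blinfun_exp ((- t) *\<^sub>R Q k) w)) \<longlonglongrightarrow> norm (blinfun_exp ((- t) *\<^sub>R Z) w)"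
      by (rule tendsto_norm[OF LIM_zero_cancel])
    then show ?thesis
      unfolding w_def by (rule LIMSEQ_le_const2) (use Qbound[OF t] in blast)
  qed
  have B: "bounded_inverse_of (gen_dom T) (gen T) (- Z)"
    unfolding bounded_inverse_of_def
  proof (intro conjI allI ballI)
    fix x
    have eq: "(- Z) x = Z (- x)" by (simp add: blinfun.minus_left blinfun.minus_right)
    show "(- Z) x \<in> gen_dom T" unfolding eq by (rule resolvent_atD(1)[OF Z])
    show "gen T ((- Z) x) = x" unfolding eq by (simp add: resolvent_atD(2)[OF Z])
  next
    fix x assume "x \<in> gen_dom T"
    from resolvent_atD(3)[OF Z this] show "(- Z) (gen T x) = x"
      by (simp add: blinfun.minus_left blinfun.minus_right)
  qed
  have C0: "0 \<le> C" unfolding C_def using K suminf_nonneg[OF sd] d0 by simp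
  have "norm (blinfun_exp (t *\<^sub>R (- Z)) o\<^sub>L (- Z)) \<le> C * (norm Z + 1)" if t: "0 \<le> t" for t
  proof (rule norm_blinfun_bound)
    fix x
    let ?y = "(- Z) x"
    have y: "?y \<in> gen_dom T" "gen T ?y = x" using B by (auto simp: bounded_inverse_of_def)
    \<comment> \<open>This writes the inverse of the generator at \<open>x\<close> as a value of
      \<open>R\<close>, where \<open>Zbound\<close> applies.\<close>
    from resolvent_atD(3)[OF resolvent_at_1 y(1)] have "R (?y - x) = ?y" by (simp add: y(2))
    then have "norm ((blinfun_exp (t *\<^sub>R (- Z)) o\<^sub>L (- Z)) x) = norm (blinfun_exp ((- t) *\<^sub>R Z) (R (?y - x)))"
      by simp
    also have "\<dots> \<le> C * norm (?y - x)" by (rule Zbound[OF t])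
    also have "norm (?y - x) \<le> (norm Z + 1) * norm x"
      using norm_triangle_ineq4[of ?y x] norm_blinfun[of "- Z" x] by (simp add: algebra_simps)
    finally show "norm ((blinfun_exp (t *\<^sub>R (- Z)) o\<^sub>L (- Z)) x) \<le> C * (norm Z + 1) * norm x"
      using C0 by (simp add: mult_left_mono mult.assoc)
  qed (use C0 in auto)
  with B show ?thesis by blast
qed

text \<open>A decreasing rate is largest at the left end of each time range, so its values at
  \<open>sqrt (2 ^ k)\<close> serve as \<open>m k\<close>.\<close>

lemma inverse_generator_flow_bounded_antimono:
  assumes \<phi>: "\<And>s t. c \<le> s \<Longrightarrow> s \<le> t \<Longrightarrow> \<phi> t \<le> \<phi> s"
    and decay: "\<And>t. c \<le> t \<Longrightarrow> norm (T t o\<^sub>L R) \<le> \<phi> t"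
    and sm: "summable (\<lambda>k. \<phi> (sqrt (2 ^ k)))"
  shows "\<exists>B. bounded_inverse_of (gen_dom T) (gen T) B \<and>
    (\<exists>C. \<forall>t\<ge>0. norm (blinfun_exp (t *\<^sub>R B) o\<^sub>L B) \<le> C)"
proof (rule inverse_generator_flow_bounded)
  \<comment> \<open>The rate is only available from \<open>c\<close> on. Finitely many
    \<open>k\<close> fall below and receive the trivial bound, which does not affect
    summability.\<close>
  define m where "m k = (if c \<le> sqrt (2 ^ k) then \<phi> (sqrt (2 ^ k)) else K * norm R)" for k :: nat
  show "norm (T s o\<^sub>L R) \<le> m k" if "s \<ge> sqrt (2 ^ k)" for k s
  proof (cases "c \<le> sqrt (2 ^ k)")
    case True
    then show ?thesis using decay[of s] \<phi>[of "sqrt (2 ^ k)" s] that by (simp add: m_def)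
  next
    case False
    have "0 \<le> s" using that by (meson order_trans real_sqrt_ge_zero zero_le_numeral zero_le_power)
    have "norm (T s o\<^sub>L R) \<le> norm (T s) * norm R" by (rule norm_blinfun_compose)
    also have "\<dots> \<le> K * norm R" by (intro mult_right_mono bound \<open>0 \<le> s\<close>) simp
    finally show ?thesis using False by (simp add: m_def)
  qed
  obtain n where n: "c < sqrt 2 ^ n" using real_arch_pow[of "sqrt 2" c] by auto
  have "c \<le> sqrt 2 ^ k" if "n \<le> k" for k
  proof -
    have "sqrt 2 ^ n \<le> sqrt 2 ^ k" by (rule power_increasing[OF that]) simp
    with n show ?thesis by linarith
  qed
  then have "eventually (\<lambda>k. c \<le> sqrt 2 ^ k) sequentially"
    unfolding eventually_sequentially by blast
  then have "eventually (\<lambda>k. m k = \<phi> (sqrt (2 ^ k))) sequentially"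
    by (rule eventually_mono) (simp add: m_def real_sqrt_power)
  from summable_cong[OF this] sm show "summable m" by simp
qed

end

theorem theorem2p13:
  fixes T :: "real \<Rightarrow> ('a::{real_inner, complete_space} \<Rightarrow>\<^sub>L 'a)"
    and R :: "'a \<Rightarrow>\<^sub>L 'a"
  assumes "c0_semigroup T"
    and "bounded_semigroup T"
    and "bounded_inverse_of (gen_dom T) (\<lambda>x. x - gen T x) R"
  shows "((\<exists>\<beta>>1. \<exists>M>0. \<exists>t0>1. \<forall>t\<ge>t0. norm (T t o\<^sub>L R) \<le> M / (ln t) powr \<beta>)
            \<longrightarrow> (\<exists>B. bounded_inverse_of (gen_dom T) (gen T) B \<and>
                    (\<exists>C. \<forall>t\<ge>0. norm (blinfun_exp (t *\<^sub>R B) o\<^sub>L B) \<le> C)))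
       \<and> ((\<exists>\<beta>>0. \<exists>M>0. \<exists>t0>0. \<forall>t\<ge>t0. norm (T t o\<^sub>L R) \<le> M * t powr (- 1 / \<beta>))
            \<longrightarrow> (\<exists>B. bounded_inverse_of (gen_dom T) (gen T) B \<and>
                    (\<exists>C. \<forall>t\<ge>0. norm (blinfun_exp (t *\<^sub>R B) o\<^sub>L B) \<le> C)))"
proof -
  obtain K where K: "\<And>t. 0 \<le> t \<Longrightarrow> norm (T t) \<le> K"
    using assms(2) by (auto simp: bounded_semigroup_def)
  interpret bounded_c0_semigroup T R "max 1 K"
    by unfold_locales (use assms K in \<open>auto simp: le_max_iff_disj\<close>)
  show ?thesis
  proof (intro conjI impI; elim exE conjE)
    fix \<beta> M t0 :: real
    assume *: "1 < \<beta>" "0 < M" "1 < t0" "\<forall>t\<ge>t0. norm (T t o\<^sub>L R) \<le> M / (ln t) powr \<beta>"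
    show "\<exists>B. bounded_inverse_of (gen_dom T) (gen T) B \<and>
        (\<exists>C. \<forall>t\<ge>0. norm (blinfun_exp (t *\<^sub>R B) o\<^sub>L B) \<le> C)"
    proof (rule inverse_generator_flow_bounded_antimono[where \<phi> = "\<lambda>t. M / (ln t) powr \<beta>" and c = t0])
      show "norm (T t o\<^sub>L R) \<le> M / (ln t) powr \<beta>" if "t0 \<le> t" for t
        using *(4) that by simp
      show "M / (ln t) powr \<beta> \<le> M / (ln s) powr \<beta>" if "t0 \<le> s" "s \<le> t" for s t
        using that * by (intro divide_left_mono powr_mono2 mult_pos_pos) auto
      \<comment> \<open>The logarithm at \<open>sqrt (2 ^ k)\<close> is linear in \<open>k\<close>,
        which turns the rate into a \<open>p\<close>-series. At \<open>k = 0\<close> both sides are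
        0 by the conventions \<open>0 powr x = 0\<close> and \<open>M / 0 = 0\<close>.\<close>
      have "M / (ln (sqrt (2 ^ k))) powr \<beta> = M / (ln 2 / 2) powr \<beta> * real k powr (- \<beta>)" for k
      proof -
        have "ln (sqrt (2 ^ k)) = ln 2 / 2 * real k" by (simp add: ln_sqrt ln_realpow)
        then have "ln (sqrt (2 ^ k)) powr \<beta> = (ln 2 / 2) powr \<beta> * real k powr \<beta>"
          by (simp only: powr_mult)
        then show ?thesis
          by (simp only: powr_minus divide_inverse inverse_mult_distrib mult.assoc)
      qed
      moreover have "summable (\<lambda>k. M / (ln 2 / 2) powr \<beta> * real k powr (- \<beta>))"
        using *(1) by (intro summable_mult) (simp add: summable_real_powr_iff)
      ultimately show "summable (\<lambda>k. M / (ln (sqrt (2 ^ k))) powr \<beta>)" by simp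
    qed
  next
    fix \<beta> M t0 :: real
    assume *: "0 < \<beta>" "0 < M" "0 < t0" "\<forall>t\<ge>t0. norm (T t o\<^sub>L R) \<le> M * t powr (- 1 / \<beta>)"
    show "\<exists>B. bounded_inverse_of (gen_dom T) (gen T) B \<and>
        (\<exists>C. \<forall>t\<ge>0. norm (blinfun_exp (t *\<^sub>R B) o\<^sub>L B) \<le> C)"
    proof (rule inverse_generator_flow_bounded_antimono[where \<phi> = "\<lambda>t. M * t powr (- 1 / \<beta>)" and c = t0])
      show "norm (T t o\<^sub>L R) \<le> M * t powr (- 1 / \<beta>)" if "t0 \<le> t" for t
        using *(4) that by simp
      show "M * t powr (- 1 / \<beta>) \<le> M * s powr (- 1 / \<beta>)" if "t0 \<le> s" "s \<le> t" for s t
        using that * by (intro mult_left_mono powr_mono2') auto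
      \<comment> \<open>A power rate sampled at \<open>sqrt (2 ^ k)\<close> is geometric with ratio
        \<open>r < 1\<close>, for every positive \<open>\<beta>\<close>.\<close>
      define r where "r = sqrt 2 powr (- 1 / \<beta>)"
      have "M * sqrt (2 ^ k) powr (- 1 / \<beta>) = M * r ^ k" for k
      proof -
        have "sqrt (2 ^ k) = sqrt 2 powr real k" by (simp add: real_sqrt_power powr_realpow)
        moreover have "r ^ k = r powr real k" by (simp add: r_def powr_realpow)
        ultimately show ?thesis by (simp only: r_def powr_powr mult.commute)
      qed
      moreover have "summable (\<lambda>k. M * r ^ k)"
      proof (intro summable_mult summable_geometric)
        have "r < sqrt 2 powr 0" unfolding r_def using *(1) by (intro powr_less_mono) auto
        then show "norm r < 1" by (simp add: r_def)
      qed
      ultimately show "summable (\<lambda>k. M * sqrt (2 ^ k) powr (- 1 / \<beta>))" by (simp only:)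
    qed
  qed
qed

end
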